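(* Let $X$ be a separable metric space, let $f:X\to X$ be a homeomorphism satisfying the closing property, let $\mu$ be an ergodic $f$-invariant Borel probability measure on $X$, let $V$ be a Banach space, and let $\mathcal{A}$ be a bounded Hölder continuous $GL(V)$-valued cocycle over $f$ with upper and lower Lyapunov exponents $\lambda(\mathcal{A},\mu)$ and $\chi(\mathcal{A},\mu)$. Then for each $\epsilon>0$ there exist $k\in\mathbb{N}$ and a point $p\in X$ with $f^kp=p$ such that $$\left|\lambda(\mathcal{A},\mu)-\frac1k\log\|\mathcal{A}_p^k\|\right|<\epsilon\quad\text{and}\quad \left|\chi(\mathcal{A},\mu)-\frac1k\log\|(\mathcal{A}_p^k)^{-1}\|^{-1}\right|<\epsilon .$$ Moreover, for any $N\in\mathbb{N}$ there exists such $p=f^kp$ with $k>N$.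
   Context: $\mathbb{N}$ denotes the positive integers. Closing property: a homeomorphism $f$ of a metric space $X$ satisfies the closing property if there exist constants $D,\gamma,\delta_0>0$ such that for any $x\in X$ and $k\in\mathbb{N}$ with $\mathrm{dist}(x,f^kx)<\delta_0$ there exists a point $p\in X$ with $f^kp=p$ such that $\mathrm{dist}(f^ix,f^ip)\le D\,\mathrm{dist}(x,f^kx)\,e^{-\gamma\min\{i,k-i\}}$ for every $i=0,\dots,k$. $L(V)$ is the space of bounded linear operators on the Banach space $V$ with the operator norm, and $GL(V)$ is the group of invertible elements of $L(V)$, with the metric $d(A,B)=\|A-B\|+\|A^{-1}-B^{-1}\|$. Cocycles: the $GL(V)$-valued cocycle over $f$ generated by a function $A:X\to GL(V)$ is the map $\mathcal{A}:X\times\mathbb{Z}\to GL(V)$, $\mathcal{A}(x,n)=\mathcal{A}_x^n$, defined by $\mathcal{A}_x^0=\mathrm{Id}$, $\mathcal{A}_x^n=A(f^{n-1}x)\circ\cdots\circ A(x)$ and $\mathcal{A}_x^{-n}=(\mathcal{A}_{f^{-n}x}^n)^{-1}$ for $n\in\mathbb{N}$. The cocycle is bounded if $A$ is a bounded function with respect to $d$ (i.e. $\|A(x)\|$ and $\|A(x)^{-1}\|$ are bounded uniformly in $x\in X$). It is Hölder continuous if for some $0<\alpha\le1$ there exists $M>0$ such that $d(A(x),A(y))\le M\,\mathrm{dist}(x,y)^\alpha$ for all sufficiently close $x,y\in X$. Lyapunov exponents: $\lambda(\mathcal{A},\mu)$ and $\chi(\mathcal{A},\mu)$ are the $\mu$-almost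 everywhere constant values of the limits $\lambda(\mathcal{A},\mu)=\lim_{n\to\infty}\frac1n\log\|\mathcal{A}_x^n\|$ and $\chi(\mathcal{A},\mu)=\lim_{n\to\infty}\frac1n\log\|(\mathcal{A}_x^n)^{-1}\|^{-1}$ for $\mu$-almost every $x$ (these limits exist and are constant a.e. by the Subadditive Ergodic Theorem). *)

theory Defs
  imports "HOL-Probability.Probability"
begin

text \<open>Periods are positive integers, hence the guard \<open>k > 0\<close>.\<close>

definition closing_property :: "('x::metric_space \<Rightarrow> 'x) \<Rightarrow> bool" where
  "closing_property f \<longleftrightarrow>
     (\<exists>D>0. \<exists>\<gamma>>0. \<exists>\<delta>\<^sub>0>0. \<forall>x. \<forall>k>0. dist x ((f ^^ k) x) < \<delta>\<^sub>0 \<longrightarrow>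
        (\<exists>p. (f ^^ k) p = p \<and>
          (\<forall>i\<le>k. dist ((f ^^ i) x) ((f ^^ i) p)
                 \<le> D * dist x ((f ^^ k) x) * exp (- \<gamma> * real (min i (k - i))))))"

definition measure_invariant :: "('x \<Rightarrow> 'x) \<Rightarrow> 'x measure \<Rightarrow> bool" where
  "measure_invariant f M \<longleftrightarrow> f \<in> measurable M M \<and>
     (\<forall>B\<in>sets M. emeasure M (f -` B \<inter> space M) = emeasure M B)"

definition measure_ergodic :: "('x \<Rightarrow> 'x) \<Rightarrow> 'x measure \<Rightarrow> bool" where
  "measure_ergodic f M \<longleftrightarrow>
     (\<forall>B\<in>sets M. f -` B \<inter> space M = B \<longrightarrow> measure M B = 0 \<or> measure M B = 1)"

definition GL :: "('v::real_normed_vector \<Rightarrow>\<^sub>L 'v) set" where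
  "GL = {T. \<exists>S. S o\<^sub>L T = id_blinfun \<and> T o\<^sub>L S = id_blinfun}"

text \<open>The inverse in the group \<open>GL\<close>; meaningful only for elements of \<open>GL\<close>.\<close>

definition blinfun_inv :: "('v::real_normed_vector \<Rightarrow>\<^sub>L 'v) \<Rightarrow> ('v \<Rightarrow>\<^sub>L 'v)" where
  "blinfun_inv T = (THE S. S o\<^sub>L T = id_blinfun \<and> T o\<^sub>L S = id_blinfun)"

definition gl_dist ::
    "('v::real_normed_vector \<Rightarrow>\<^sub>L 'v) \<Rightarrow> ('v \<Rightarrow>\<^sub>L 'v) \<Rightarrow> real" where
  "gl_dist S T = norm (S - T) + norm (blinfun_inv S - blinfun_inv T)"

primrec cocycle_nat ::
    "('x \<Rightarrow> 'x) \<Rightarrow> ('x \<Rightarrow> ('v::real_normed_vector \<Rightarrow>\<^sub>L 'v)) \<Rightarrow> 'x \<Rightarrow> nat \<Rightarrow> ('v \<Rightarrow>\<^sub>L 'v)" where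
  "cocycle_nat f A x 0 = id_blinfun"
| "cocycle_nat f A x (Suc n) = A ((f ^^ n) x) o\<^sub>L cocycle_nat f A x n"

definition cocycle ::
    "('x \<Rightarrow> 'x) \<Rightarrow> ('x \<Rightarrow> ('v::real_normed_vector \<Rightarrow>\<^sub>L 'v)) \<Rightarrow> 'x \<Rightarrow> int \<Rightarrow> ('v \<Rightarrow>\<^sub>L 'v)" where
  "cocycle f A x n =
     (if n \<ge> 0 then cocycle_nat f A x (nat n)
      else blinfun_inv (cocycle_nat f A ((inv f ^^ nat (- n)) x) (nat (- n))))"

lemma cocycle_of_nat [simp]: "cocycle f A x (int n) = cocycle_nat f A x n"
  by (simp add: cocycle_def)

definition bounded_generator :: "('x \<Rightarrow> ('v::real_normed_vector \<Rightarrow>\<^sub>L 'v)) \<Rightarrow> bool" where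
  "bounded_generator A \<longleftrightarrow> (\<exists>C. \<forall>x. norm (A x) \<le> C \<and> norm (blinfun_inv (A x)) \<le> C)"

text \<open>``Sufficiently close'' is uniform: one threshold \<open>r\<close> serves all pairs of points.\<close>

definition hoelder_generator ::
    "('x::metric_space \<Rightarrow> ('v::real_normed_vector \<Rightarrow>\<^sub>L 'v)) \<Rightarrow> bool" where
  "hoelder_generator A \<longleftrightarrow>
     (\<exists>\<alpha>>0. \<alpha> \<le> 1 \<and>
       (\<exists>M>0. \<exists>r>0. \<forall>x y. dist x y < r \<longrightarrow> gl_dist (A x) (A y) \<le> M * dist x y powr \<alpha>))"

text \<open>The Lyapunov exponents are the almost everywhere constant values of the limits. Existence of
  these values is not part of the definitions; for an ergodic measure and a bounded continuous
  generator it is the content of the Subadditive Ergodic Theorem.\<close>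

definition upper_lyapunov ::
    "'x measure \<Rightarrow> ('x \<Rightarrow> 'x) \<Rightarrow> ('x \<Rightarrow> ('v::real_normed_vector \<Rightarrow>\<^sub>L 'v)) \<Rightarrow> real" where
  "upper_lyapunov M f A =
     (THE l. AE x in M. (\<lambda>n. 1 / real n * ln (norm (cocycle f A x (int n)))) \<longlonglongrightarrow> l)"

definition lower_lyapunov ::
    "'x measure \<Rightarrow> ('x \<Rightarrow> 'x) \<Rightarrow> ('x \<Rightarrow> ('v::real_normed_vector \<Rightarrow>\<^sub>L 'v)) \<Rightarrow> real" where
  "lower_lyapunov M f A =
     (THE c. AE x in M.
        (\<lambda>n. 1 / real n * ln (inverse (norm (blinfun_inv (cocycle f A x (int n)))))) \<longlonglongrightarrow> c)"

end

theory Submission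
  imports Defs
begin

text \<open>
  Let \<open>a n x = ln \<parallel>A\<^sub>x\<^sup>n\<parallel>\<close> and \<open>b n x = ln \<parallel>(A\<^sub>x\<^sup>n)\<inverse>\<parallel>\<close>; both are subadditive, with rates \<open>\<lambda>\<close> and \<open>- \<chi>\<close>.
  Almost every \<open>x\<close> satisfies a tempered upper bound
  \<open>a m (f\<^sup>j x) \<le> (\<lambda> + \<eta>) m + \<eta> j + K\<close>, and returns to each of its neighbourhoods within every window
  \<open>[n, (1 + s) n]\<close> with \<open>n\<close> large. By the argument of Karlsson and Margulis, applied to \<open>a + b\<close>, on a set
  of positive measure there are infinitely many \<open>n\<close> with
  \<open>a (n - i) (f\<^sup>i x) + (\<lambda> - 2 \<eta>) i \<le> a n x + K\<close> for all \<open>i \<le> n\<close>, and likewise for \<open>b\<close>.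

  Take such an \<open>n\<close>, a close return time \<open>k\<close> with \<open>(1 + s) n \<le> k \<le> n + 3 s n + 2\<close>, and the periodic
  point \<open>p\<close> given by the closing property. Stopping at \<open>n\<close>, before the orbits separate from the end of the
  period, makes \<open>min j (k - j) \<ge> s j\<close>, so the distance of \<open>f\<^sup>j x\<close> and \<open>f\<^sup>j p\<close> decays exponentially in \<open>j\<close>
  at a rate that beats \<open>\<eta>\<close>. Telescoping \<open>A\<^sub>x\<^sup>n - A\<^sub>p\<^sup>n\<close> then shows that \<open>\<parallel>A\<^sub>p\<^sup>n\<parallel>\<close> is \<open>\<parallel>A\<^sub>x\<^sup>n\<parallel>\<close> up to a
  factor of exponential order \<open>\<eta> n\<close>, and the remaining \<open>k - n\<close> steps cost at most a multiple of \<open>s n\<close>.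
\<close>

section \<open>Subadditive processes over an ergodic system\<close>

locale ergodic_system = prob_space M for M :: "'x measure" +
  fixes f :: "'x \<Rightarrow> 'x"
  assumes space_UNIV: "space M = UNIV"
    and invariant: "measure_invariant f M"
    and ergodic: "measure_ergodic f M"
begin

lemma f_measurable [measurable]: "f \<in> measurable M M"
  using invariant by (simp add: measure_invariant_def)

lemma funpow_measurable [measurable]: "f ^^ n \<in> measurable M M"
  by (induction n) auto

lemma distr_f: "distr M M f = M"
proof (rule measure_eqI)
  fix B assume "B \<in> sets (distr M M f)"
  then show "emeasure (distr M M f) B = emeasure M B"
    using invariant by (simp add: emeasure_distr measure_invariant_def)
qed simp

lemma integral_funpow:
  fixes g :: "'x \<Rightarrow> real"
  assumes [measurable]: "g \<in> borel_measurable M"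
  shows "(\<integral>x. g ((f ^^ n) x) \<partial>M) = (\<integral>x. g x \<partial>M)"
proof (induction n)
  case (Suc n)
  have "(\<integral>x. g ((f ^^ n) x) \<partial>M) = (\<integral>x. g ((f ^^ n) x) \<partial>distr M M f)"
    by (simp add: distr_f)
  also have "\<dots> = (\<integral>x. g ((f ^^ Suc n) x) \<partial>M)"
    by (subst integral_distr) (simp_all add: funpow_swap1)
  finally show ?case using Suc by simp
qed simp

text \<open>Increments bounded at both ends of an orbit segment stand in for integrability: they
  bound \<open>a n\<close> by \<open>C * n\<close> and make the passage from \<open>x\<close> to
  \<open>f x\<close> a bounded error. For a cocycle they express that the generator and its inverse
  are bounded.\<close>

definition tame :: "(nat \<Rightarrow> 'x \<Rightarrow> real) \<Rightarrow> real \<Rightarrow> bool" where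
  "tame a C \<longleftrightarrow> (\<forall>n. a n \<in> borel_measurable M) \<and> (\<forall>x. a 0 x = 0) \<and>
     (\<forall>m n x. a (m + n) x \<le> a m x + a n ((f ^^ m) x)) \<and>
     (\<forall>n x. \<bar>a (Suc n) x - a n (f x)\<bar> \<le> C) \<and> (\<forall>n x. \<bar>a (Suc n) x - a n x\<bar> \<le> C)"

lemma tameI:
  assumes "\<And>n. a n \<in> borel_measurable M" "\<And>x. a 0 x = 0"
    "\<And>m n x. a (m + n) x \<le> a m x + a n ((f ^^ m) x)"
    "\<And>n x. \<bar>a (Suc n) x - a n (f x)\<bar> \<le> C" "\<And>n x. \<bar>a (Suc n) x - a n x\<bar> \<le> C"
  shows "tame a C"
  using assms by (simp add: tame_def)

context
  fixes a C assumes tame: "tame a C"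
begin

lemma tame_measurable [measurable]: "a n \<in> borel_measurable M"
  and tame_0: "a 0 x = 0"
  and tame_subadd: "a (m + n) x \<le> a m x + a n ((f ^^ m) x)"
  and tame_first: "\<bar>a (Suc n) x - a n (f x)\<bar> \<le> C"
  and tame_last: "\<bar>a (Suc n) x - a n x\<bar> \<le> C"
  using tame by (simp_all add: tame_def)

lemma tame_C_nonneg: "0 \<le> C"
  using tame_last[of 0 undefined] by linarith

lemma tame_lipschitz: "\<bar>a (n + m) x - a n x\<bar> \<le> C * real m"
proof (induction m)
  case (Suc m)
  then show ?case using tame_last[of "n + m" x] by (simp add: algebra_simps abs_le_iff)
qed simp

lemma tame_bound: "\<bar>a n x\<bar> \<le> C * real n"
  using tame_lipschitz[of 0 n x] by (simp add: tame_0)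

lemma tame_integrable: "integrable M (a n)"
  by (rule integrable_const_bound[where B = "C * real n"]) (auto simp: tame_bound)

text \<open>\<open>E\<close> is the set where the lower limit of \<open>a n x / n\<close> is below
  \<open>c\<close>. The gap \<open>1 / Suc j\<close> makes it exactly invariant: replacing
  \<open>x\<close> by \<open>f x\<close> changes \<open>a n\<close> by at most \<open>2 * C\<close>,
  which a smaller gap absorbs for large \<open>n\<close>. Then ergodicity applies.\<close>

lemma tame_low_set_null_or_full:
  fixes c :: real
  defines "E \<equiv> {x. \<exists>j. \<exists>\<^sub>F n in sequentially. a n x < (c - 1 / real (Suc j)) * real n}"
  shows "E \<in> sets M" "measure M E = 0 \<or> measure M E = 1"
proof -
  have E_eq: "E = {x \<in> space M. \<exists>j. \<forall>m. \<exists>n. n \<ge> m \<and> a n x < (c - 1 / real (Suc j)) * real n}"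
    by (simp add: E_def frequently_sequentially space_UNIV)
  show E_sets: "E \<in> sets M"
    unfolding E_eq by measurable
  have step: "\<exists>j. \<exists>\<^sub>F n in sequentially. u n < (c - 1 / real (Suc j)) * real n"
    if low: "\<exists>\<^sub>F n in sequentially. v n < (c - 1 / real (Suc j)) * real n"
      and near: "\<And>n. u n \<le> v n + K" for u v :: "nat \<Rightarrow> real" and j K
  proof -
    have gap: "1 / real (Suc j) - 1 / real (Suc (Suc j)) > 0"
      by (simp add: divide_strict_left_mono)
    obtain n0 where n0: "real n0 * (1 / real (Suc j) - 1 / real (Suc (Suc j))) > K"
      using reals_Archimedean3[OF gap] by blast
    have "\<forall>\<^sub>F n in sequentially. v n < (c - 1 / real (Suc j)) * real n \<longrightarrow>
        u n < (c - 1 / real (Suc (Suc j))) * real n"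
    proof (rule eventually_sequentiallyI[of n0], intro impI)
      fix n assume "n0 \<le> n" and v: "v n < (c - 1 / real (Suc j)) * real n"
      then have "real n0 * (1 / real (Suc j) - 1 / real (Suc (Suc j)))
          \<le> real n * (1 / real (Suc j) - 1 / real (Suc (Suc j)))"
        using gap by (intro mult_right_mono) auto
      then have "K < real n * (1 / real (Suc j) - 1 / real (Suc (Suc j)))"
        using n0 by linarith
      then show "u n < (c - 1 / real (Suc (Suc j))) * real n"
        using near[of n] v by (simp only: algebra_simps)
    qed
    then show ?thesis
      using low by (blast intro: frequently_rev_mp)
  qed
  have near: "a n x \<le> a n (f x) + 2 * C" "a n (f x) \<le> a n x + 2 * C" for n x
    using tame_first[of n x] tame_last[of n x] by linarith+
  have "f -` E \<inter> space M = E"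
  proof (intro equalityI subsetI)
    fix x assume "x \<in> f -` E \<inter> space M"
    then obtain j where "\<exists>\<^sub>F n in sequentially. a n (f x) < (c - 1 / real (Suc j)) * real n"
      by (auto simp: E_def)
    from step[OF this, of "\<lambda>n. a n x" "2 * C"] show "x \<in> E"
      using near unfolding E_def by blast
  next
    fix x assume "x \<in> E"
    then obtain j where "\<exists>\<^sub>F n in sequentially. a n x < (c - 1 / real (Suc j)) * real n"
      by (auto simp: E_def)
    from step[OF this, of "\<lambda>n. a n (f x)" "2 * C"] show "x \<in> f -` E \<inter> space M"
      using near by (simp add: E_def space_UNIV)
  qed
  then show "measure M E = 0 \<or> measure M E = 1"
    using ergodic E_sets unfolding measure_ergodic_def by blast
qed

text \<open>The covering argument of Katznelson and Weiss: cut the orbit greedily into blocks with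
  \<open>a n y < c n\<close>, and give up one step at each visit to the set where no such block of length at most \<open>N\<close>
  starts.\<close>

lemma covering_bound:
  assumes nonpos: "\<And>n x. a n x \<le> 0" and "c \<le> 0"
  shows "a m x \<le> c * (real m - real N -
    (\<Sum>t<m. indicator {y. \<forall>n\<in>{1..N}. a n y \<ge> c * real n} ((f ^^ t) x)))"
proof (induction m arbitrary: x rule: less_induct)
  case (less m)
  define B where "B = {y. \<forall>n\<in>{1..N}. a n y \<ge> c * real n}"
  define S where "S k y = (\<Sum>t<k. indicator B ((f ^^ t) y) :: real)" for k y
  have IH: "a k y \<le> c * (real k - real N - S k y)" if "k < m" for k y
    using less.IH[OF that] by (simp add: S_def B_def)
  have S_nonneg: "0 \<le> S k y" for k y
    by (simp add: S_def sum_nonneg)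
  have S_add: "S (k + l) y = S k y + S l ((f ^^ k) y)" for k l y
  proof (induction l)
    case (Suc l)
    have "(f ^^ (k + l)) y = (f ^^ l) ((f ^^ k) y)"
      by (subst add.commute) (simp add: funpow_add)
    then show ?case using Suc by (simp add: S_def)
  qed (simp add: S_def)
  have "a m x \<le> c * (real m - real N - S m x)"
  proof (cases "m \<le> N")
    \<comment> \<open>The allowance \<open>N\<close> is for a last block cut off by the end of the
      segment: here it makes the right side nonnegative.\<close>
    case True
    then have "real m - real N - S m x \<le> 0"
      using S_nonneg[of m x] by linarith
    then show ?thesis
      using nonpos[of m x] \<open>c \<le> 0\<close> by (meson mult_nonpos_nonpos order_trans)
  next
    case False
    show ?thesis
    proof (cases "x \<in> B")
      case True
      have S1: "S m x = 1 + S (m - 1) (f x)"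
        using S_add[of 1 "m - 1" x] False True by (simp add: S_def)
      have "a m x \<le> a 1 x + a (m - 1) (f x)"
        using tame_subadd[of 1 "m - 1" x] False by simp
      also have "\<dots> \<le> c * (real (m - 1) - real N - S (m - 1) (f x))"
        using nonpos[of 1 x] IH[of "m - 1" "f x"] False by simp
      also have "\<dots> = c * (real m - real N - S m x)"
        using False by (simp add: S1 of_nat_diff)
      finally show ?thesis .
    next
      case nB: False
      then obtain n where n: "1 \<le> n" "n \<le> N" "a n x < c * real n"
        by (auto simp: B_def not_le)
      have "m = n + (m - n)" using n False by simp
      then have Sm: "S m x = S n x + S (m - n) ((f ^^ n) x)"
        using S_add[of n "m - n" x] by simp
      have "a m x \<le> a n x + a (m - n) ((f ^^ n) x)"
        using tame_subadd[of n "m - n" x] \<open>m = n + (m - n)\<close> by simp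
      also have "\<dots> \<le> c * real n + c * (real (m - n) - real N - S (m - n) ((f ^^ n) x))"
        using n IH[of "m - n" "(f ^^ n) x"] False by (intro add_mono) auto
      \<comment> \<open>Visits to \<open>B\<close> inside the block are dropped, which only raises
        the bound because \<open>c \<le> 0\<close>.\<close>
      also have "\<dots> = c * (real m - real N - S m x) + c * S n x"
        using n False by (simp add: Sm of_nat_diff algebra_simps)
      also have "\<dots> \<le> c * (real m - real N - S m x)"
        using \<open>c \<le> 0\<close> S_nonneg[of n x] by (simp add: mult_nonpos_nonneg)
      finally show ?thesis .
    qed
  qed
  then show ?case by (simp add: S_def B_def)
qed

text \<open>Integrating \<open>covering_bound\<close> and dividing by \<open>m\<close> gives
  \<open>l \<le> c' * (1 - measure M (B N))\<close>. If the lower limit were below \<open>c'\<close>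
  almost everywhere, the sets \<open>B N\<close> would shrink to a null set and force
  \<open>l \<le> c'\<close>.\<close>

lemma tame_liminf_nonpos:
  assumes nonpos: "\<And>n x. a n x \<le> 0"
    and int: "\<And>n. (\<integral>x. a n x \<partial>M) \<ge> l * real n" and "c < l"
  shows "AE x in M. \<forall>\<^sub>F n in sequentially. a n x \<ge> c * real n"
proof -
  have "(\<integral>x. a 1 x \<partial>M) \<le> 0"
    using integral_mono[OF tame_integrable, of "\<lambda>_. 0" 1] nonpos by simp
  then have "l \<le> 0" using int[of 1] by simp
  then have "c < 0" using \<open>c < l\<close> by simp
  \<comment> \<open>The intermediate value leaves room twice: \<open>c' < l\<close> for the
    contradiction, and \<open>c < c'\<close> for the gap in the definition of
    \<open>E\<close>.\<close>
  obtain c' where c': "c < c'" "c' < l" using dense[OF \<open>c < l\<close>] by blast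
  have "c' \<le> 0" using c' \<open>l \<le> 0\<close> by simp
  define E where "E = {x. \<exists>j. \<exists>\<^sub>F n in sequentially. a n x < (c' - 1 / real (Suc j)) * real n}"
  have E_sets: "E \<in> sets M" and E01: "measure M E = 0 \<or> measure M E = 1"
    using tame_low_set_null_or_full[of c'] by (simp_all add: E_def)
  have "measure M E \<noteq> 1"
  proof
    assume "measure M E = 1"
    then have AE_E: "AE x in M. x \<in> E"
      using E_sets by (simp add: prob_eq_1)
    define B where "B N = {y. \<forall>n\<in>{1..N}. a n y \<ge> c' * real n}" for N
    have "B N = {y \<in> space M. \<forall>n\<in>{1..N}. a n y \<ge> c' * real n}" for N
      by (simp add: B_def space_UNIV)
    then have B_sets [measurable]: "B N \<in> sets M" for N
      by simp
    have "AE x in M. x \<notin> (\<Inter>N. B N)"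
      using AE_E
    proof eventually_elim
      case (elim x)
      then obtain j where "\<exists>\<^sub>F n in sequentially. a n x < (c' - 1 / real (Suc j)) * real n"
        by (auto simp: E_def)
      then obtain n where n: "n \<ge> 1" "a n x < (c' - 1 / real (Suc j)) * real n"
        by (auto simp: frequently_sequentially)
      have "(c' - 1 / real (Suc j)) * real n \<le> c' * real n"
        by (intro mult_right_mono) auto
      then have "a n x < c' * real n" using n by linarith
      then have "x \<notin> B n" using n by (auto simp: B_def not_le)
      then show ?case by blast
    qed
    moreover have "(\<Inter>N. B N) \<in> sets M"
      using B_sets by (intro sets.countable_INT) auto
    ultimately have "measure M (\<Inter>N. B N) = 0"
      using prob_eq_0 by blast
    moreover have "(\<lambda>N. measure M (B N)) \<longlonglongrightarrow> measure M (\<Inter>N. B N)"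
      using B_sets by (intro finite_Lim_measure_decseq) (force simp: B_def decseq_def)+
    ultimately have lim: "(\<lambda>N. measure M (B N)) \<longlonglongrightarrow> 0" by simp
    have "l \<le> c' * (1 - measure M (B N))" for N
    proof -
      have "l * real m \<le> c' * (real m - real N - real m * measure M (B N))" for m
      proof -
        have ind: "integrable M (\<lambda>x. indicator (B N) ((f ^^ t) x) :: real)" for t
          by (rule integrable_const_bound[where B = 1]) (auto simp: indicator_def)
        have int_ind: "(\<integral>x. indicator (B N) ((f ^^ t) x) \<partial>M) = measure M (B N)" for t
          using integral_funpow[of "indicator (B N)" t] by (simp add: space_UNIV)
        have "l * real m \<le> (\<integral>x. a m x \<partial>M)" by (rule int)
        also have "\<dots> \<le> (\<integral>x. c' * (real m - real N - (\<Sum>t<m. indicator (B N) ((f ^^ t) x))) \<partial>M)"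
          using covering_bound[OF nonpos \<open>c' \<le> 0\<close>]
          by (intro integral_mono tame_integrable integrable_mult_right
                Bochner_Integration.integrable_diff Bochner_Integration.integrable_sum ind)
             (auto simp: B_def)
        also have "\<dots> = c' * (real m - real N - real m * measure M (B N))"
          using ind by (simp add: int_ind prob_space)
        finally show ?thesis .
      qed
      then have "c' * real N \<le> real m * (c' * (1 - measure M (B N)) - l)" for m
        by (simp add: algebra_simps)
      then have upper: "real m * (l - c' * (1 - measure M (B N))) \<le> - c' * real N" for m
        by (simp add: algebra_simps)
      \<comment> \<open>A positive \<open>l - c' * (1 - measure M (B N))\<close> would have
        unbounded multiples, while \<open>upper\<close> bounds them independently of
        \<open>m\<close>.\<close>
      show ?thesis
      proof (rule ccontr)
        assume "\<not> ?thesis"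
        then have "0 < l - c' * (1 - measure M (B N))" by simp
        from reals_Archimedean3[OF this] show False
          using upper by (meson not_le)
      qed
    qed
    moreover have "(\<lambda>N. c' * (1 - measure M (B N))) \<longlonglongrightarrow> c' * (1 - 0)"
      by (intro tendsto_intros lim)
    ultimately have "l \<le> c'"
      by (intro LIMSEQ_le_const[where X = "\<lambda>N. c' * (1 - measure M (B N))"]) auto
    then show False using c' by simp
  qed
  then have "AE x in M. x \<notin> E"
    using E01 E_sets by (simp add: prob_eq_0)
  then show ?thesis
  proof eventually_elim
    case (elim x)
    obtain j where j: "1 / real (Suc j) < c' - c"
      using reals_Archimedean[of "c' - c"] c' by (auto simp: inverse_eq_divide)
    have "\<forall>\<^sub>F n in sequentially. \<not> a n x < (c' - 1 / real (Suc j)) * real n"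
      using elim by (auto simp: E_def not_frequently)
    then show ?case
    proof eventually_elim
      case (elim n)
      have "c * real n \<le> (c' - 1 / real (Suc j)) * real n"
        using j by (intro mult_right_mono) auto
      then show ?case using elim by linarith
    qed
  qed
qed

end

lemma tame_add_linear:
  assumes "tame a C"
  shows "tame (\<lambda>n x. a n x + d * real n) (C + \<bar>d\<bar>)"
proof (rule tameI)
  fix n x
  show "\<bar>a (Suc n) x + d * real (Suc n) - (a n (f x) + d * real n)\<bar> \<le> C + \<bar>d\<bar>"
    using tame_first[OF assms, of n x] by (simp add: algebra_simps)
  show "\<bar>a (Suc n) x + d * real (Suc n) - (a n x + d * real n)\<bar> \<le> C + \<bar>d\<bar>"
    using tame_last[OF assms, of n x] by (simp add: algebra_simps)
next
  fix m n x
  show "a (m + n) x + d * real (m + n) \<le> a m x + d * real m + (a n ((f ^^ m) x) + d * real n)"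
    using tame_subadd[OF assms, of m n x] by (simp add: algebra_simps)
qed (use tame_measurable[OF assms] tame_0[OF assms] in auto)

text \<open>Adding \<open>- C * n\<close> makes the process nonpositive, as the covering argument
  requires. The countably many bounds \<open>l - 1 / Suc j\<close> suffice to place the quantifier
  over \<open>c\<close> inside the almost everywhere statement.\<close>

theorem tame_liminf:
  assumes "tame a C" and int: "\<And>n. (\<integral>x. a n x \<partial>M) \<ge> l * real n"
  shows "AE x in M. \<forall>c<l. \<forall>\<^sub>F n in sequentially. a n x \<ge> c * real n"
proof -
  note tame = tame_add_linear[OF assms(1), of "- C"]
  have "AE x in M. \<forall>\<^sub>F n in sequentially. a n x \<ge> (l - 1 / real (Suc j)) * real n" for j
  proof -
    have "AE x in M. \<forall>\<^sub>F n in sequentially.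
        a n x + - C * real n \<ge> (l - C - 1 / real (Suc j)) * real n"
    proof (rule tame_liminf_nonpos[OF tame, where l = "l - C"])
      show "a n x + - C * real n \<le> 0" for n x
        using tame_bound[OF assms(1), of n x] by simp
      show "(l - C) * real n \<le> (\<integral>x. a n x + - C * real n \<partial>M)" for n
        using int[of n] tame_integrable[OF assms(1)] by (simp add: prob_space algebra_simps)
    qed simp
    then show ?thesis
      by (simp add: algebra_simps)
  qed
  then have "AE x in M. \<forall>j. \<forall>\<^sub>F n in sequentially. a n x \<ge> (l - 1 / real (Suc j)) * real n"
    by (simp add: AE_all_countable)
  then show ?thesis
  proof eventually_elim
    case (elim x)
    show ?case
    proof (intro allI impI)
      fix c assume "c < l"
      then obtain j where j: "1 / real (Suc j) < l - c"
        using reals_Archimedean[of "l - c"] by (auto simp: inverse_eq_divide)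
      have "\<forall>\<^sub>F n in sequentially. a n x \<ge> (l - 1 / real (Suc j)) * real n"
        using elim by blast
      then show "\<forall>\<^sub>F n in sequentially. a n x \<ge> c * real n"
      proof eventually_elim
        case (elim n)
        have "c * real n \<le> (l - 1 / real (Suc j)) * real n"
          using j by (intro mult_right_mono) auto
        then show ?case using elim by linarith
      qed
    qed
  qed
qed

end

section \<open>Averages and growth rates\<close>

lemma sum_lessThan_add:
  fixes g :: "nat \<Rightarrow> 'b::comm_monoid_add"
  shows "(\<Sum>t<m + n. g t) = (\<Sum>t<m. g t) + (\<Sum>t<n. g (m + t))"
  by (induction n) (simp_all add: add.assoc)

lemma eventually_le_imp_le_add_const:
  fixes u v :: "nat \<Rightarrow> real"
  assumes "\<forall>\<^sub>F n in sequentially. u n \<le> v n"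
  obtains K where "0 \<le> K" "\<And>n. u n \<le> v n + K"
proof -
  obtain N where N: "\<And>n. n \<ge> N \<Longrightarrow> u n \<le> v n"
    using assms by (auto simp: eventually_sequentially)
  have "u n \<le> v n + (\<Sum>i<N. \<bar>u i - v i\<bar>)" for n
  proof (cases "n < N")
    case True
    then have "\<bar>u n - v n\<bar> \<le> (\<Sum>i<N. \<bar>u i - v i\<bar>)"
      by (intro member_le_sum) auto
    then show ?thesis by linarith
  next
    case False
    then show ?thesis using N[of n] by (simp add: add_increasing2 sum_nonneg)
  qed
  then show thesis by (intro that[of "\<Sum>i<N. \<bar>u i - v i\<bar>"]) (auto simp: sum_nonneg)
qed

context ergodic_system
begin

section \<open>Birkhoff sums and the pointwise ergodic theorem\<close>

definition birkhoff_sum :: "('x \<Rightarrow> real) \<Rightarrow> nat \<Rightarrow> 'x \<Rightarrow> real" where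
  "birkhoff_sum g n x = (\<Sum>t<n. g ((f ^^ t) x))"

lemma birkhoff_sum_add:
  "birkhoff_sum g (m + n) x = birkhoff_sum g m x + birkhoff_sum g n ((f ^^ m) x)"
proof -
  have "(f ^^ (m + t)) x = (f ^^ t) ((f ^^ m) x)" for t
    by (subst add.commute) (simp add: funpow_add)
  then show ?thesis by (simp add: birkhoff_sum_def sum_lessThan_add)
qed

lemma tame_birkhoff_sum:
  assumes [measurable]: "g \<in> borel_measurable M" and "\<And>x. \<bar>g x\<bar> \<le> C"
  shows "tame (birkhoff_sum g) C"
proof (rule tameI)
  show "birkhoff_sum g n \<in> borel_measurable M" for n
    unfolding birkhoff_sum_def by measurable
  fix n x
  show "\<bar>birkhoff_sum g (Suc n) x - birkhoff_sum g n (f x)\<bar> \<le> C"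
    using assms(2) birkhoff_sum_add[of g 1 n x] by (simp add: birkhoff_sum_def)
  show "\<bar>birkhoff_sum g (Suc n) x - birkhoff_sum g n x\<bar> \<le> C"
    using assms(2) by (simp add: birkhoff_sum_def)
qed (simp_all add: birkhoff_sum_add, simp add: birkhoff_sum_def)

lemma integral_birkhoff_sum:
  assumes [measurable]: "g \<in> borel_measurable M" and "\<And>x. \<bar>g x\<bar> \<le> C"
  shows "(\<integral>x. birkhoff_sum g n x \<partial>M) = real n * (\<integral>x. g x \<partial>M)"
proof -
  have "integrable M (\<lambda>x. g ((f ^^ t) x))" for t
    using assms(2) by (intro integrable_const_bound[where B = C]) auto
  then show ?thesis
    by (simp add: birkhoff_sum_def integral_funpow)
qed

text \<open>The sums of \<open>g\<close> and of \<open>- g\<close> are both tame, with integrals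
  exactly linear in \<open>n\<close>, so two applications of \<open>tame_liminf\<close> enclose
  them. The additive \<open>K\<close> makes the estimate valid for every \<open>n\<close>, as needed
  when it is used at two times at once.\<close>

theorem birkhoff:
  assumes [measurable]: "g \<in> borel_measurable M" and bound: "\<And>x. \<bar>g x\<bar> \<le> C"
  shows "AE x in M. \<forall>\<epsilon>>0. \<exists>K. \<forall>n. \<bar>birkhoff_sum g n x - real n * (\<integral>x. g x \<partial>M)\<bar> \<le> \<epsilon> * real n + K"
proof -
  define I where "I = (\<integral>x. g x \<partial>M)"
  have neg: "birkhoff_sum (\<lambda>x. - g x) n x = - birkhoff_sum g n x" for n x
    by (simp add: birkhoff_sum_def sum_negf)
  have "AE x in M. \<forall>c<I. \<forall>\<^sub>F n in sequentially. birkhoff_sum g n x \<ge> c * real n"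
    by (rule tame_liminf[OF tame_birkhoff_sum[OF assms]])
      (simp_all add: integral_birkhoff_sum[OF assms] I_def)
  moreover have "AE x in M. \<forall>c<(- I). \<forall>\<^sub>F n in sequentially.
      birkhoff_sum (\<lambda>x. - g x) n x \<ge> c * real n"
  proof (rule tame_liminf[OF tame_birkhoff_sum])
    show "(\<integral>x. birkhoff_sum (\<lambda>x. - g x) n x \<partial>M) \<ge> - I * real n" for n
      using bound by (subst integral_birkhoff_sum) (auto simp: I_def)
  qed (use bound in auto)
  ultimately show ?thesis
  proof eventually_elim
    case (elim x)
    show ?case
    proof (intro allI impI)
      fix \<epsilon> :: real assume "0 < \<epsilon>"
      have "\<forall>\<^sub>F n in sequentially. birkhoff_sum g n x \<ge> (I - \<epsilon>) * real n"
        "\<forall>\<^sub>F n in sequentially. birkhoff_sum (\<lambda>x. - g x) n x \<ge> (- I - \<epsilon>) * real n"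
        using elim \<open>0 < \<epsilon>\<close> by simp_all
      then have "\<forall>\<^sub>F n in sequentially. \<bar>birkhoff_sum g n x - real n * I\<bar> \<le> \<epsilon> * real n"
        by eventually_elim (simp add: neg abs_le_iff algebra_simps)
      from eventually_le_imp_le_add_const[OF this]
      show "\<exists>K. \<forall>n. \<bar>birkhoff_sum g n x - real n * (\<integral>x. g x \<partial>M)\<bar> \<le> \<epsilon> * real n + K"
        unfolding I_def by metis
    qed
  qed
qed

section \<open>Growth rates, tempered bounds and Kingman's theorem\<close>

text \<open>The infimum of Fekete's lemma. It starts at 1 because the quotient at 0 evaluates to 0
  and would cap the infimum.\<close>

definition rate :: "(nat \<Rightarrow> 'x \<Rightarrow> real) \<Rightarrow> real" where
  "rate a = (INF n\<in>{1..}. (\<integral>x. a n x \<partial>M) / real n)"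

context
  fixes a C assumes tame: "tame a C"
begin

lemma rate_le: "rate a * real n \<le> (\<integral>x. a n x \<partial>M)"
proof (cases "n = 0")
  case True
  then show ?thesis using tame_0[OF tame] by simp
next
  case False
  have lower: "- C \<le> (\<integral>x. a k x \<partial>M) / real k" if "k \<in> {1..}" for k
  proof -
    have "(\<integral>x. - C * real k \<partial>M) \<le> (\<integral>x. a k x \<partial>M)"
      using tame_bound[OF tame, of k] tame_integrable[OF tame]
      by (intro integral_mono) (auto simp: abs_le_iff minus_le_iff)
    then show ?thesis using that by (simp add: prob_space field_simps)
  qed
  have "rate a \<le> (\<integral>x. a n x \<partial>M) / real n"
    unfolding rate_def using False lower by (intro cINF_lower bdd_belowI2[of _ "- C"]) auto
  then show ?thesis using False by (simp add: field_simps)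
qed

lemma rate_approx:
  assumes "0 < \<epsilon>"
  obtains N where "0 < N" "(\<integral>x. a N x \<partial>M) \<le> (rate a + \<epsilon>) * real N"
proof -
  have "\<exists>N\<in>{1..}. (\<integral>x. a N x \<partial>M) / real N < rate a + \<epsilon>"
  proof (rule ccontr)
    assume "\<not> ?thesis"
    then have "rate a + \<epsilon> \<le> rate a"
      unfolding rate_def[of a, symmetric]
      by (subst (2) rate_def) (intro cINF_greatest, auto simp: not_less)
    then show False using assms by simp
  qed
  then obtain N where N: "N \<ge> 1" "(\<integral>x. a N x \<partial>M) / real N < rate a + \<epsilon>" by auto
  then show thesis by (intro that[of N]) (auto simp: field_simps)
qed

text \<open>Cut the segment into blocks of length \<open>N\<close> starting at an offset
  \<open>r < N\<close>. Summed over all offsets, the block starting points run through every time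
  once, which produces a full Birkhoff sum of \<open>a N\<close>. What is left at the ends is
  bounded by the Lipschitz property.\<close>

lemma block_average:
  assumes "0 < N"
  obtains K where "\<And>m y. real N * a m y \<le> birkhoff_sum (a N) m y + K"
proof -
  have block: "a (q * N) y \<le> (\<Sum>i<q. a N ((f ^^ (i * N)) y))" for q y
  proof (induction q)
    case (Suc q)
    have "a (Suc q * N) y \<le> a (q * N) y + a N ((f ^^ (q * N)) y)"
      using tame_subadd[OF tame, of "q * N" N y] by (simp add: add.commute)
    then show ?case using Suc by simp
  qed (simp add: tame_0[OF tame])
  have "real N * a m y \<le> birkhoff_sum (a N) m y + 4 * real N * (C * real N)" for m y
  proof -
    define q where "q = m div N"
    have m: "m = q * N + m mod N" by (simp add: q_def)
    have small: "C * real r \<le> C * real N" if "r < N" for r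
      using that tame_C_nonneg[OF tame] by (intro mult_left_mono) auto
    have mod: "m mod N < N" using assms by simp
    \<comment> \<open>Three errors of size \<open>C * N\<close>: cutting \<open>m\<close> to a
      multiple of \<open>N\<close>, lengthening by \<open>r\<close>, and the initial piece of length
      \<open>r\<close>. The fourth one in the total comes from completing \<open>q * N\<close> to
      \<open>m\<close>.\<close>
    have each: "a m y \<le> 3 * (C * real N) + (\<Sum>i<q. a N ((f ^^ (i * N + r)) y))" if "r < N" for r
    proof -
      have "\<bar>a m y - a (q * N) y\<bar> \<le> C * real N"
        using tame_lipschitz[OF tame, of "q * N" "m mod N" y] small[OF mod] m by auto
      moreover have "\<bar>a (r + q * N) y - a (q * N) y\<bar> \<le> C * real N"
        using tame_lipschitz[OF tame, of "q * N" r y] small[OF that] by (simp add: add.commute)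
      moreover have "a (r + q * N) y \<le> a r y + a (q * N) ((f ^^ r) y)"
        by (rule tame_subadd[OF tame])
      moreover have "a r y \<le> C * real N"
        using tame_bound[OF tame, of r y] small[OF that] by linarith
      moreover have "a (q * N) ((f ^^ r) y) \<le> (\<Sum>i<q. a N ((f ^^ (i * N + r)) y))"
        using block[of q "(f ^^ r) y"] by (simp add: funpow_add)
      ultimately show ?thesis by linarith
    qed
    have "real N * a m y = (\<Sum>r<N. a m y)" by simp
    also have "\<dots> \<le> (\<Sum>r<N. 3 * (C * real N) + (\<Sum>i<q. a N ((f ^^ (i * N + r)) y)))"
      by (intro sum_mono each) auto
    also have "\<dots> = 3 * real N * (C * real N) + (\<Sum>r<N. \<Sum>i<q. a N ((f ^^ (i * N + r)) y))"
      by (simp add: sum.distrib)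
    also have "(\<Sum>r<N. \<Sum>i<q. a N ((f ^^ (i * N + r)) y)) = birkhoff_sum (a N) (q * N) y"
    proof -
      have "(\<Sum>i<k. \<Sum>r<N. a N ((f ^^ (i * N + r)) y)) = birkhoff_sum (a N) (k * N) y" for k
      proof (induction k)
        case (Suc k)
        have "birkhoff_sum (a N) (k * N + N) y
            = birkhoff_sum (a N) (k * N) y + (\<Sum>r<N. a N ((f ^^ (k * N + r)) y))"
          unfolding birkhoff_sum_def by (rule sum_lessThan_add)
        then show ?case using Suc by (simp add: add.commute)
      qed (simp add: birkhoff_sum_def)
      then show ?thesis by (subst sum.swap)
    qed
    also have "\<dots> \<le> birkhoff_sum (a N) m y + real N * (C * real N)"
    proof -
      have "\<bar>birkhoff_sum (a N) (m mod N) z\<bar> \<le> (\<Sum>r<m mod N. C * real N)" for z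
        unfolding birkhoff_sum_def
        by (rule order_trans[OF sum_abs]) (intro sum_mono tame_bound[OF tame])
      moreover have "(\<Sum>r<m mod N. C * real N) \<le> real N * (C * real N)"
        using mod tame_C_nonneg[OF tame] by (simp add: mult_right_mono)
      ultimately have "\<bar>birkhoff_sum (a N) (m mod N) ((f ^^ (q * N)) y)\<bar> \<le> real N * (C * real N)"
        using order_trans by blast
      moreover have "birkhoff_sum (a N) m y = birkhoff_sum (a N) (q * N) y
          + birkhoff_sum (a N) (m mod N) ((f ^^ (q * N)) y)"
        using birkhoff_sum_add[of "a N" "q * N" "m mod N" y] m by simp
      ultimately show ?thesis by linarith
    qed
    finally show ?thesis by (simp add: algebra_simps)
  qed
  then show thesis by (rule that)
qed

text \<open>The block average at \<open>f ^^ j\<close> of \<open>x\<close> is a difference of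
  Birkhoff sums of \<open>x\<close> itself, at times \<open>j + m\<close> and \<open>j\<close>.
  Hence one constant \<open>K\<close> serves all subsegments of the orbit, at the price of an error
  growing with \<open>j\<close>.\<close>

theorem tame_tempered:
  "AE x in M. \<forall>\<epsilon>>0. \<exists>K. \<forall>j m. a m ((f ^^ j) x) \<le> (rate a + \<epsilon>) * real m + \<epsilon> * real j + K"
proof -
  have "AE x in M. \<forall>N. \<forall>\<epsilon>>0. \<exists>K. \<forall>n.
      \<bar>birkhoff_sum (a N) n x - real n * (\<integral>x. a N x \<partial>M)\<bar> \<le> \<epsilon> * real n + K"
    unfolding AE_all_countable
  proof
    fix N
    show "AE x in M. \<forall>\<epsilon>>0. \<exists>K. \<forall>n.
        \<bar>birkhoff_sum (a N) n x - real n * (\<integral>x. a N x \<partial>M)\<bar> \<le> \<epsilon> * real n + K"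
      using tame_bound[OF tame] by (intro birkhoff tame_measurable[OF tame])
  qed
  then show ?thesis
  proof eventually_elim
    case (elim x)
    show ?case
    proof (intro allI impI)
      fix \<epsilon> :: real assume "0 < \<epsilon>"
      then obtain N where N: "0 < N" "(\<integral>x. a N x \<partial>M) \<le> (rate a + \<epsilon> / 2) * real N"
        using rate_approx[of "\<epsilon> / 2"] by auto
      define I where "I = (\<integral>x. a N x \<partial>M)"
      obtain K1 where K1: "\<And>m y. real N * a m y \<le> birkhoff_sum (a N) m y + K1"
        using block_average[OF N(1)] by blast
      have "real N * \<epsilon> / 2 > 0" using N \<open>0 < \<epsilon>\<close> by simp
      then obtain K2 where
        K2: "\<And>n. \<bar>birkhoff_sum (a N) n x - real n * I\<bar> \<le> real N * \<epsilon> / 2 * real n + K2"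
        using elim unfolding I_def by metis
      have "a m ((f ^^ j) x) \<le> (rate a + \<epsilon>) * real m + \<epsilon> * real j + (2 * K2 + K1) / real N"
        for j m
      proof -
        have "real N * a m ((f ^^ j) x) \<le> birkhoff_sum (a N) (j + m) x - birkhoff_sum (a N) j x + K1"
          using K1[of m "(f ^^ j) x"] by (simp add: birkhoff_sum_add)
        also have "\<dots> \<le> real m * I + real N * \<epsilon> / 2 * real (j + m) + real N * \<epsilon> / 2 * real j
            + 2 * K2 + K1"
          using K2[of "j + m"] K2[of j] by (simp add: abs_le_iff algebra_simps)
        also have "real m * I \<le> real m * ((rate a + \<epsilon> / 2) * real N)"
          using N by (intro mult_left_mono) (auto simp: I_def)
        finally have "real N * a m ((f ^^ j) x)
            \<le> real N * ((rate a + \<epsilon>) * real m + \<epsilon> * real j) + (2 * K2 + K1)"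
          by (simp add: algebra_simps add_divide_distrib)
        then show ?thesis using N(1) by (simp add: field_simps)
      qed
      then show "\<exists>K. \<forall>j m. a m ((f ^^ j) x) \<le> (rate a + \<epsilon>) * real m + \<epsilon> * real j + K"
        by blast
    qed
  qed
qed

text \<open>The upper bound is \<open>tame_tempered\<close> at \<open>j = 0\<close>, the lower one
  is \<open>tame_liminf\<close> with \<open>l = rate a\<close>.\<close>

theorem kingman: "AE x in M. (\<lambda>n. a n x / real n) \<longlonglongrightarrow> rate a"
  using tame_tempered tame_liminf[OF tame rate_le]
proof eventually_elim
  case (elim x)
  show ?case
  proof (rule LIMSEQ_I)
    fix r :: real assume "0 < r"
    then obtain K where "\<And>j m. a m ((f ^^ j) x) \<le> (rate a + r / 2) * real m + r / 2 * real j + K"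
      using elim(1) half_gt_zero by metis
    from this[of _ 0] have K: "\<And>m. a m x \<le> (rate a + r / 2) * real m + K" by simp
    obtain n0 where n0: "real n0 * (r / 2) > K"
      using reals_Archimedean3[of "r / 2"] \<open>0 < r\<close> by auto
    have "\<forall>\<^sub>F n in sequentially. a n x \<ge> (rate a - r / 2) * real n"
      using elim(2) \<open>0 < r\<close> by simp
    then obtain n1 where n1: "\<And>n. n \<ge> n1 \<Longrightarrow> a n x \<ge> (rate a - r / 2) * real n"
      by (auto simp: eventually_sequentially)
    have "norm (a n x / real n - rate a) < r" if "n \<ge> Suc (n0 + n1)" for n
    proof -
      have "real n0 * (r / 2) \<le> real n * (r / 2)"
        using that \<open>0 < r\<close> by (intro mult_right_mono) auto
      then have "K < real n * (r / 2)" using n0 by linarith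
      then have "a n x < (rate a + r) * real n"
        using K[of n] by (simp add: algebra_simps)
      moreover have "(rate a - r) * real n < (rate a - r / 2) * real n"
        using that \<open>0 < r\<close> by (intro mult_strict_right_mono) auto
      then have "(rate a - r) * real n < a n x"
        using n1[of n] that by linarith
      ultimately show ?thesis using that by (simp add: field_simps abs_less_iff)
    qed
    then show "\<exists>no. \<forall>n\<ge>no. norm (a n x / real n - rate a) < r" by blast
  qed
qed

end

end

section \<open>Leading times and recurrence\<close>

text \<open>The running maximum of \<open>t\<close> moves only at record times, and by at most
  \<open>C\<close> there. Quantifying over all \<open>j \<le> M\<close> lets the induction carry the
  maximum.\<close>

lemma record_times_bound:
  fixes t :: "nat \<Rightarrow> real"
  assumes "t 0 = 0" "\<And>m. m < M \<Longrightarrow> t (Suc m) - t m \<le> C" "0 \<le> C" "j \<le> M"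
  shows "t j \<le> (\<Sum>m<M. if \<forall>i\<le>m. t i \<le> t (Suc m) then C else 0)"
  using assms(2,4)
proof (induction M arbitrary: j)
  case 0
  then show ?case using assms(1) by simp
next
  case (Suc M)
  let ?S = "\<lambda>M. \<Sum>m<M. if \<forall>i\<le>m. t i \<le> t (Suc m) then C else 0"
  have IH: "t i \<le> ?S M" if "i \<le> M" for i
    using Suc.IH[OF _ that] Suc.prems(1) by simp
  have mono: "?S M \<le> ?S (Suc M)" using \<open>0 \<le> C\<close> by simp
  show ?case
  proof (cases "j \<le> M")
    case True
    then show ?thesis using IH[of j] mono by linarith
  next
    case False
    then have j: "j = Suc M" using Suc.prems by simp
    show ?thesis
    proof (cases "\<forall>i\<le>M. t i \<le> t (Suc M)")
      case True
      then show ?thesis using j IH[of M] Suc.prems(1)[of M] by simp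
    next
      case False
      then obtain i where "i \<le> M" "t (Suc M) < t i" by (auto simp: not_le)
      then show ?thesis using IH[OF \<open>i \<le> M\<close>] mono unfolding j by linarith
    qed
  qed
qed

context ergodic_system
begin

text \<open>Along the reversed orbit segment \<open>t k = a k (f\<^bsup>m-k\<^esup> x) - (l - \<epsilon>) k\<close>, a record time \<open>k\<close> of \<open>t\<close> is one at
  which \<open>f\<^bsup>m-k\<^esup> x\<close> has the required property. Since \<open>t\<close> grows by \<open>\<epsilon> m\<close> on average with bounded steps,
  records have positive density.\<close>

theorem karlsson_margulis:
  assumes tame: "tame a C" and int: "\<And>n. l * real n \<le> (\<integral>x. a n x \<partial>M)" and "0 < \<epsilon>"
  shows "\<not> (AE x in M. \<forall>\<^sub>F m in sequentially.
    \<not> (\<forall>i\<le>m. a (m - i) ((f ^^ i) x) + (l - \<epsilon>) * real i \<le> a m x))"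
proof
  define G where "G m = {x. \<forall>i\<le>m. a (m - i) ((f ^^ i) x) + (l - \<epsilon>) * real i \<le> a m x}" for m
  assume "AE x in M. \<forall>\<^sub>F m in sequentially.
    \<not> (\<forall>i\<le>m. a (m - i) ((f ^^ i) x) + (l - \<epsilon>) * real i \<le> a m x)"
  then have evG: "AE x in M. \<forall>\<^sub>F m in sequentially. x \<notin> G m" by (simp add: G_def)
  note tame_measurable[OF tame, measurable]
  have "G m = {x \<in> space M. \<forall>i\<in>{..m}. a (m - i) ((f ^^ i) x) + (l - \<epsilon>) * real i \<le> a m x}" for m
    by (auto simp: G_def space_UNIV)
  then have G_sets [measurable]: "G m \<in> sets M" for m by simp
  \<comment> \<open>A bound for the increments of \<open>t\<close>; the summand 1 makes it
    positive.\<close>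
  define C' where "C' = C + \<bar>l - \<epsilon>\<bar> + 1"
  have "C' > 0" using tame_C_nonneg[OF tame] by (simp add: C'_def)
  have bound: "a m x - (l - \<epsilon>) * real m \<le> (\<Sum>k<m. C' * indicator (G (Suc k)) ((f ^^ (m - Suc k)) x))"
    for m x
  proof -
    define t where "t k = a k ((f ^^ (m - k)) x) - (l - \<epsilon>) * real k" for k
    have "t m \<le> (\<Sum>k<m. if \<forall>i\<le>k. t i \<le> t (Suc k) then C' else 0)"
    proof (rule record_times_bound)
      show "t 0 = 0" by (simp add: t_def tame_0[OF tame])
      show "t (Suc k) - t k \<le> C'" if "k < m" for k
      proof -
        have "f ((f ^^ (m - Suc k)) x) = (f ^^ (m - k)) x"
          using that by (metis Suc_diff_Suc comp_apply funpow.simps(2))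
        then have "\<bar>a (Suc k) ((f ^^ (m - Suc k)) x) - a k ((f ^^ (m - k)) x)\<bar> \<le> C"
          using tame_first[OF tame, of k "(f ^^ (m - Suc k)) x"] by simp
        then show ?thesis by (simp add: t_def C'_def algebra_simps)
      qed
    qed (use \<open>C' > 0\<close> in auto)
    also have "\<dots> \<le> (\<Sum>k<m. C' * indicator (G (Suc k)) ((f ^^ (m - Suc k)) x))"
    proof (intro sum_mono)
      fix k assume "k \<in> {..<m}"
      then have k: "k < m" by simp
      \<comment> \<open>For \<open>i > 0\<close> the inequality of \<open>G\<close> compares the
        record with the earlier time \<open>Suc k - i\<close>; for \<open>i = 0\<close> it is
        trivial.\<close>
      have "(f ^^ (m - Suc k)) x \<in> G (Suc k)" if rec: "\<forall>i\<le>k. t i \<le> t (Suc k)"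
        unfolding G_def mem_Collect_eq
      proof (intro allI impI)
        fix i assume i: "i \<le> Suc k"
        show "a (Suc k - i) ((f ^^ i) ((f ^^ (m - Suc k)) x)) + (l - \<epsilon>) * real i
            \<le> a (Suc k) ((f ^^ (m - Suc k)) x)"
        proof (cases "i = 0")
          case False
          have "m - (Suc k - i) = i + (m - Suc k)" using i k by simp
          then have "(f ^^ i) ((f ^^ (m - Suc k)) x) = (f ^^ (m - (Suc k - i))) x"
            by (simp only: funpow_add o_apply)
          moreover have "t (Suc k - i) \<le> t (Suc k)" using rec False by auto
          ultimately show ?thesis
            using i by (simp add: t_def of_nat_diff algebra_simps)
        qed simp
      qed
      then show "(if \<forall>i\<le>k. t i \<le> t (Suc k) then C' else 0)
          \<le> C' * indicator (G (Suc k)) ((f ^^ (m - Suc k)) x)"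
        using \<open>C' > 0\<close> by auto
    qed
    finally show ?thesis by (simp add: t_def)
  qed
  \<comment> \<open>By invariance each shifted indicator integrates to the measure of its set, so
    the average measure of the sets \<open>G\<close> is at least
    \<open>\<epsilon> / C'\<close>.\<close>
  have "\<epsilon> * real m \<le> C' * (\<Sum>k<m. measure M (G (Suc k)))" for m
  proof -
    have ind: "integrable M (\<lambda>x. indicator (G k) ((f ^^ t) x) :: real)" for t k
      by (rule integrable_const_bound[where B = 1]) (auto simp: indicator_def)
    have int_ind: "(\<integral>x. indicator (G k) ((f ^^ t) x) \<partial>M) = measure M (G k)" for t k
      using integral_funpow[of "indicator (G k)" t] by (simp add: space_UNIV)
    have "\<epsilon> * real m \<le> (\<integral>x. a m x - (l - \<epsilon>) * real m \<partial>M)"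
      using int[of m] tame_integrable[OF tame] by (simp add: prob_space algebra_simps)
    also have "\<dots> \<le> (\<integral>x. (\<Sum>k<m. C' * indicator (G (Suc k)) ((f ^^ (m - Suc k)) x)) \<partial>M)"
      by (intro integral_mono bound Bochner_Integration.integrable_diff tame_integrable[OF tame]
          Bochner_Integration.integrable_sum integrable_mult_right ind) auto
    also have "\<dots> = (\<Sum>k<m. \<integral>x. C' * indicator (G (Suc k)) ((f ^^ (m - Suc k)) x) \<partial>M)"
      by (intro Bochner_Integration.integral_sum integrable_mult_right ind)
    also have "\<dots> = C' * (\<Sum>k<m. measure M (G (Suc k)))"
      by (simp add: int_ind sum_distrib_left)
    finally show ?thesis .
  qed
  note density = this
  \<comment> \<open>These unions decrease to the set of points with infinitely many leading times,
    null by assumption. From some \<open>N\<close> on, each \<open>G m\<close> then has measure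
    below half the density just found.\<close>
  define U where "U N = (\<Union>m\<in>{N..}. G m)" for N
  have U_sets: "U N \<in> sets M" for N
    unfolding U_def by measurable
  have int_sets: "(\<Inter>N. U N) \<in> sets M"
    using U_sets by (intro sets.countable_INT) auto
  have "AE x in M. x \<notin> (\<Inter>N. U N)"
    using evG by eventually_elim (auto simp: U_def eventually_sequentially)
  then have "measure M (\<Inter>N. U N) = 0"
    using prob_eq_0[OF int_sets] by blast
  moreover have "(\<lambda>N. measure M (U N)) \<longlonglongrightarrow> measure M (\<Inter>N. U N)"
    using U_sets by (intro finite_Lim_measure_decseq) (force simp: U_def decseq_def)+
  ultimately have "(\<lambda>N. measure M (U N)) \<longlonglongrightarrow> 0" by simp
  then have "\<forall>\<^sub>F N in sequentially. measure M (U N) < \<epsilon> / (2 * C')"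
    using \<open>0 < \<epsilon>\<close> \<open>C' > 0\<close> by (intro order_tendstoD) auto
  then obtain N where N: "measure M (U N) < \<epsilon> / (2 * C')"
    by (auto simp: eventually_sequentially)
  have "\<epsilon> / 2 * real m \<le> C' * real N" for m
  proof -
    have "(\<Sum>k<m. measure M (G (Suc k))) \<le> (\<Sum>k<m. (if k < N then 1 else 0) + \<epsilon> / (2 * C'))"
    proof (intro sum_mono)
      fix k
      have "measure M (G (Suc k)) \<le> measure M (U N)" if "N \<le> k"
        using that U_sets by (intro finite_measure_mono) (auto simp: U_def intro!: bexI[of _ "Suc k"])
      then show "measure M (G (Suc k)) \<le> (if k < N then 1 else 0) + \<epsilon> / (2 * C')"
        using N prob_le_1[of "G (Suc k)"] \<open>0 < \<epsilon>\<close> \<open>C' > 0\<close> by (auto simp: add_increasing2)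
    qed
    also have "\<dots> \<le> real N + real m * (\<epsilon> / (2 * C'))"
    proof -
      have "(\<Sum>k<m. if k < N then 1 else 0) = real (card ({..<m} \<inter> {..<N}))"
        by (simp add: sum.If_cases lessThan_def)
      also have "\<dots> \<le> real N"
        using card_mono[of "{..<N}" "{..<m} \<inter> {..<N}"] by simp
      finally show ?thesis by (simp add: sum.distrib)
    qed
    finally have "C' * (\<Sum>k<m. measure M (G (Suc k))) \<le> C' * (real N + real m * (\<epsilon> / (2 * C')))"
      using \<open>C' > 0\<close> by (intro mult_left_mono) auto
    moreover have "C' * (real N + real m * (\<epsilon> / (2 * C'))) = C' * real N + \<epsilon> / 2 * real m"
      using \<open>C' > 0\<close> by (simp add: field_simps)
    ultimately show ?thesis using density[of m] by linarith
  qed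
  then show False
    using reals_Archimedean3[of "\<epsilon> / 2"] \<open>0 < \<epsilon>\<close>
    by (metis half_gt_zero mult.commute not_le)
qed

text \<open>Without a visit in the window the visit counts up to \<open>n\<close> and up to
  \<open>(1 + s) * n\<close> would agree, although Birkhoff's theorem makes them differ by about
  \<open>measure M B * s * n\<close>.\<close>

lemma visits_in_window:
  assumes B [measurable]: "B \<in> sets M"
  shows "AE x in M. 0 < measure M B \<longrightarrow>
    (\<forall>s>0. \<forall>\<^sub>F n in sequentially. \<exists>k\<ge>n. real k \<le> (1 + s) * real n \<and> (f ^^ k) x \<in> B)"
proof -
  have "\<bar>indicator B x :: real\<bar> \<le> 1" for x by (simp add: indicator_def)
  moreover have "indicator B \<in> borel_measurable M" by simp
  ultimately have "AE x in M. \<forall>\<epsilon>>0. \<exists>K. \<forall>n.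
      \<bar>birkhoff_sum (indicator B) n x - real n * measure M B\<bar> \<le> \<epsilon> * real n + K"
    using birkhoff[of "indicator B" 1] by (simp add: space_UNIV)
  then show ?thesis
  proof eventually_elim
    case (elim x)
    show ?case
    proof (intro impI allI)
      fix s :: real assume \<theta>: "0 < measure M B" and "0 < s"
      define \<theta> where "\<theta> = measure M B"
      \<comment> \<open>The errors at the two ends of the window, \<open>\<eta> * n\<close> and
        \<open>\<eta> * (1 + s) * n\<close>, then add up to half of the expected count.\<close>
      define \<eta> where "\<eta> = \<theta> * s / (2 * (2 + s))"
      have "0 < \<theta>" using \<theta> by (simp add: \<theta>_def)
      then have "0 < \<eta>" using \<open>0 < s\<close> by (simp add: \<eta>_def)
      then obtain K where
        K: "\<And>n. \<bar>birkhoff_sum (indicator B) n x - real n * \<theta>\<bar> \<le> \<eta> * real n + K"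
        using elim unfolding \<theta>_def by blast
      have eta: "\<eta> * (2 + s) = \<theta> * s / 2"
        using \<open>0 < s\<close> unfolding \<eta>_def by (simp add: divide_simps)
      have "\<eta> \<le> \<theta>"
      proof -
        have "\<theta> * s \<le> \<theta> * (2 * (2 + s))"
          using \<open>0 < \<theta>\<close> \<open>0 < s\<close> by (intro mult_left_mono) auto
        then show ?thesis using \<open>0 < s\<close> by (simp add: \<eta>_def divide_le_eq)
      qed
      have "0 < \<theta> * s / 2" using \<open>0 < \<theta>\<close> \<open>0 < s\<close> by simp
      from reals_Archimedean3[OF this] obtain n0 where n0: "2 * K < real n0 * (\<theta> * s / 2)"
        by blast
      show "\<forall>\<^sub>F n in sequentially. \<exists>k\<ge>n. real k \<le> (1 + s) * real n \<and> (f ^^ k) x \<in> B"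
      proof (rule eventually_sequentiallyI[of n0], rule ccontr)
        fix n assume "n0 \<le> n" and
          no: "\<not> (\<exists>k\<ge>n. real k \<le> (1 + s) * real n \<and> (f ^^ k) x \<in> B)"
        define m where "m = nat \<lfloor>(1 + s) * real n\<rfloor>"
        have m: "real m \<le> (1 + s) * real n" "(1 + s) * real n \<le> real (Suc m)"
          using \<open>0 < s\<close> unfolding m_def by (simp_all add: of_nat_floor) linarith
        have "n \<le> m"
          using \<open>0 < s\<close> unfolding m_def by (intro le_nat_floor) (simp add: algebra_simps)
        then have "Suc m = n + (Suc m - n)" by simp
        moreover have "birkhoff_sum (indicator B) (Suc m - n) ((f ^^ n) x) = (0::real)"
          unfolding birkhoff_sum_def
        proof (intro sum.neutral ballI)
          fix t assume "t \<in> {..<Suc m - n}"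
          then have "t + n \<le> m" by auto
          then have "real (t + n) \<le> (1 + s) * real n" using m(1) by linarith
          then have "(f ^^ (t + n)) x \<notin> B" using no by (metis le_add2)
          then show "indicator B ((f ^^ t) ((f ^^ n) x)) = (0::real)"
            by (simp add: funpow_add)
        qed
        ultimately have eq: "birkhoff_sum (indicator B) (Suc m) x = (birkhoff_sum (indicator B) n x :: real)"
          using birkhoff_sum_add[of "indicator B" n "Suc m - n" x] by simp
        have "(\<theta> - \<eta>) * ((1 + s) * real n) \<le> (\<theta> - \<eta>) * real (Suc m)"
          using m(2) \<open>\<eta> \<le> \<theta>\<close> by (intro mult_left_mono) auto
        also have "\<dots> \<le> (\<theta> + \<eta>) * real n + 2 * K"
          using K[of n] K[of "Suc m"] eq by (simp add: abs_le_iff algebra_simps)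
        finally have "real n * (\<theta> * s - \<eta> * (2 + s)) \<le> 2 * K"
          by (simp add: algebra_simps)
        then have "real n * (\<theta> * s / 2) \<le> 2 * K"
          unfolding eta by simp
        moreover have "real n0 * (\<theta> * s / 2) \<le> real n * (\<theta> * s / 2)"
          using \<open>n0 \<le> n\<close> \<open>0 < \<theta>\<close> \<open>0 < s\<close> by (intro mult_right_mono) auto
        ultimately show False using n0 by linarith
      qed
    qed
  qed
qed

end

text \<open>Balls of radius \<open>1 / Suc j\<close> about a countable dense set form a countable
  family. Almost every point avoids its null members, so each small ball containing \<open>x\<close>
  has positive measure and is visited in every late window.\<close>

theorem recurrence_in_window:
  fixes M :: "'x::metric_space measure"
  assumes "ergodic_system M f" and sets: "sets M = sets borel"
    and sep: "separable_space (euclidean :: 'x topology)"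
  shows "AE x in M. \<forall>r>0. \<forall>s>0. \<forall>\<^sub>F n in sequentially.
    \<exists>k\<ge>n. real k \<le> (1 + s) * real n \<and> dist x ((f ^^ k) x) < r"
proof -
  interpret ergodic_system M f by fact
  obtain Q :: "'x set" where Q: "countable Q" "closure Q = UNIV"
    using sep by (auto simp: separable_space_def)
  define \<B> where "\<B> = (\<lambda>(q, j). ball q (1 / real (Suc j))) ` (Q \<times> UNIV)"
  have "countable \<B>" using Q by (simp add: \<B>_def)
  have B_sets: "B \<in> sets M" if "B \<in> \<B>" for B
    using that by (auto simp: \<B>_def sets)
  have "AE x in M. \<forall>B\<in>\<B>. 0 < measure M B \<longrightarrow>
    (\<forall>s>0. \<forall>\<^sub>F n in sequentially. \<exists>k\<ge>n. real k \<le> (1 + s) * real n \<and> (f ^^ k) x \<in> B)"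
    using \<open>countable \<B>\<close> visits_in_window B_sets by (subst AE_ball_countable) auto
  moreover have "AE x in M. \<forall>B\<in>\<B>. measure M B = 0 \<longrightarrow> x \<notin> B"
    using \<open>countable \<B>\<close> B_sets prob_eq_0 by (subst AE_ball_countable) auto
  ultimately show ?thesis
  proof eventually_elim
    case (elim x)
    show ?case
    proof (intro allI impI)
      fix r s :: real assume "0 < r" "0 < s"
      obtain j where j: "1 / real (Suc j) < r / 2"
        using reals_Archimedean[of "r / 2"] \<open>0 < r\<close> by (auto simp: inverse_eq_divide)
      have "x \<in> closure Q" using Q by simp
      moreover have "0 < 1 / real (Suc j)" by simp
      ultimately obtain q where q: "q \<in> Q" "dist q x < 1 / real (Suc j)"
        unfolding closure_approachable by blast
      define B where "B = ball q (1 / real (Suc j))"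
      have "B \<in> \<B>" using q by (auto simp: B_def \<B>_def)
      have "x \<in> B" using q by (simp add: B_def)
      then have "0 < measure M B"
        using elim(2) \<open>B \<in> \<B>\<close> zero_less_measure_iff by blast
      then have "\<forall>\<^sub>F n in sequentially. \<exists>k\<ge>n. real k \<le> (1 + s) * real n \<and> (f ^^ k) x \<in> B"
        using elim(1) \<open>B \<in> \<B>\<close> \<open>0 < s\<close> by blast
      moreover have "dist x y < r" if "y \<in> B" for y
        using dist_triangle[of x y q] that \<open>x \<in> B\<close> j by (simp add: B_def dist_commute)
      ultimately show "\<forall>\<^sub>F n in sequentially.
          \<exists>k\<ge>n. real k \<le> (1 + s) * real n \<and> dist x ((f ^^ k) x) < r"
        by (elim eventually_mono) blast
    qed
  qed
qed

section \<open>Cocycles in a normed monoid\<close>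

text \<open>The multiplication is a parameter because the inverses \<open>(A\<^sub>x\<^sup>n)\<inverse>\<close> form a cocycle generated by
  \<open>A\<inverse>\<close> for the reversed composition. Over the zero space \<open>growth\<close> is \<open>ln 0 = 0\<close>, so \<open>exp (growth n x)\<close>
  is then 1 and not the norm; the estimates below are stated so as to hold in this case too.\<close>

locale bounded_cocycle = bounded_bilinear mul
  for mul :: "'b::real_normed_vector \<Rightarrow> 'b \<Rightarrow> 'b" +
  fixes e :: 'b and f :: "'x \<Rightarrow> 'x" and A B :: "'x \<Rightarrow> 'b" and C :: real
  assumes mul_assoc: "mul (mul a b) c = mul a (mul b c)"
    and mul_e: "mul a e = a" "mul e a = a"
    and norm_mul: "norm (mul a b) \<le> norm a * norm b"
    and norm_e: "norm e \<le> 1"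
    and inverses: "mul (A x) (B x) = e" "mul (B x) (A x) = e"
    and norm_A: "norm (A x) \<le> exp C" and norm_B: "norm (B x) \<le> exp C"
    and C_nonneg: "0 \<le> C"
begin

primrec iter :: "nat \<Rightarrow> 'x \<Rightarrow> 'b" where
  "iter 0 x = e"
| "iter (Suc n) x = mul (A ((f ^^ n) x)) (iter n x)"

definition growth :: "nat \<Rightarrow> 'x \<Rightarrow> real" where
  "growth n x = ln (norm (iter n x))"

lemma iter_add: "iter (m + n) x = mul (iter n ((f ^^ m) x)) (iter m x)"
proof (induction n)
  case (Suc n)
  have "(f ^^ (m + n)) x = (f ^^ n) ((f ^^ m) x)"
    by (subst add.commute) (simp add: funpow_add)
  then show ?case using Suc by (simp add: mul_assoc)
qed (simp add: mul_e)

lemma iter_Suc_first: "iter (Suc n) x = mul (iter n (f x)) (A x)"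
  using iter_add[of 1 n x] by (simp add: mul_e)

text \<open>Submultiplicativity gives \<open>norm e \<ge> 1\<close> unless \<open>e = 0\<close>, and
  then the whole space collapses.\<close>

lemma norm_e_cases: "norm e = 1 \<or> (\<forall>a::'b. a = 0)"
proof (cases "e = 0")
  case True
  then have "a = 0" for a :: 'b using mul_e(1)[of a] zero_right[of a] by simp
  then show ?thesis by blast
next
  case False
  have "norm e \<le> norm e * norm e" using norm_mul[of e e] by (simp add: mul_e)
  then show ?thesis using False norm_e by (simp add: mult_le_cancel_left1)
qed

lemma norm_iter_pos:
  assumes "norm e = 1"
  shows "0 < norm (iter n x)"
proof (induction n)
  case (Suc n)
  have "iter n x = mul (B ((f ^^ n) x)) (iter (Suc n) x)"
    by (simp add: mul_assoc[symmetric] inverses mul_e)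
  then show ?case using Suc by (metis zero_less_norm_iff zero_right)
qed (simp add: assms)

lemma growth_trivial: "\<not> norm e = 1 \<Longrightarrow> growth n x = 0"
  using norm_e_cases unfolding growth_def by (metis ln_0 norm_zero)

lemma exp_growth: "norm e = 1 \<Longrightarrow> exp (growth n x) = norm (iter n x)"
  using norm_iter_pos by (simp add: growth_def)

lemma growth_0: "growth 0 x = 0"
  using growth_trivial[of 0 x] by (cases "norm e = 1") (auto simp: growth_def)

lemma growth_subadd: "growth (m + n) x \<le> growth m x + growth n ((f ^^ m) x)"
proof (cases "norm e = 1")
  case True
  have "exp (growth (m + n) x) \<le> exp (growth m x + growth n ((f ^^ m) x))"
    using norm_mul[of "iter n ((f ^^ m) x)" "iter m x"]
    by (simp add: exp_growth[OF True] exp_add iter_add mult.commute)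
  then show ?thesis by simp
qed (simp add: growth_trivial)

lemma growth_1: "growth 1 x \<le> C"
proof (cases "norm e = 1")
  case True
  then have "exp (growth 1 x) \<le> exp C"
    using norm_A by (simp add: exp_growth mul_e)
  then show ?thesis by simp
qed (simp add: growth_trivial C_nonneg)

lemma growth_le_of_mul:
  assumes "norm (iter m x) \<le> exp C * norm (iter n y)"
  shows "growth m x \<le> C + growth n y"
proof (cases "norm e = 1")
  case True
  then have "exp (growth m x) \<le> exp (C + growth n y)"
    using assms by (simp add: exp_growth exp_add)
  then show ?thesis by simp
qed (simp add: growth_trivial C_nonneg)

text \<open>One direction is subadditivity; the other cancels the first factor by its inverse
  \<open>B x\<close>.\<close>

lemma growth_first: "\<bar>growth (Suc n) x - growth n (f x)\<bar> \<le> C"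
proof -
  have "growth (Suc n) x \<le> C + growth n (f x)"
    using growth_subadd[of 1 n x] growth_1[of x] by simp
  moreover have "growth n (f x) \<le> C + growth (Suc n) x"
  proof (rule growth_le_of_mul)
    have "iter n (f x) = mul (iter (Suc n) x) (B x)"
      by (simp only: iter_Suc_first mul_assoc inverses mul_e)
    then have "norm (iter n (f x)) \<le> norm (iter (Suc n) x) * norm (B x)"
      by (metis norm_mul)
    also have "\<dots> \<le> norm (iter (Suc n) x) * exp C"
      by (intro mult_left_mono norm_B) auto
    finally show "norm (iter n (f x)) \<le> exp C * norm (iter (Suc n) x)"
      by (simp only: mult.commute)
  qed
  ultimately show ?thesis by linarith
qed

lemma growth_last: "\<bar>growth (Suc n) x - growth n x\<bar> \<le> C"
proof -
  have "growth (Suc n) x \<le> growth n x + C"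
    using growth_subadd[of n 1 x] growth_1[of "(f ^^ n) x"] by simp
  moreover have "growth n x \<le> C + growth (Suc n) x"
  proof (rule growth_le_of_mul)
    have "iter n x = mul (B ((f ^^ n) x)) (iter (Suc n) x)"
      by (simp add: mul_assoc[symmetric] inverses mul_e)
    then have "norm (iter n x) \<le> norm (B ((f ^^ n) x)) * norm (iter (Suc n) x)"
      by (metis norm_mul)
    also have "\<dots> \<le> exp C * norm (iter (Suc n) x)"
      by (intro mult_right_mono norm_B) auto
    finally show "norm (iter n x) \<le> exp C * norm (iter (Suc n) x)" .
  qed
  ultimately show ?thesis by linarith
qed

lemma growth_lipschitz:
  assumes "n \<le> k"
  shows "\<bar>growth k x - growth n x\<bar> \<le> C * (real k - real n)"
  using assms
proof (induction k rule: dec_induct)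
  case (step k)
  have "\<bar>growth (Suc k) x - growth n x\<bar> \<le> \<bar>growth k x - growth n x\<bar> + C"
    using growth_last[of k x] by linarith
  then show ?case using step.IH by (simp add: algebra_simps)
qed simp

text \<open>Telescoping: the factors along the orbit of \<open>p\<close> are exchanged for those of
  \<open>x\<close> one at a time, so that the \<open>j\<close>-th term has \<open>p\<close> before
  time \<open>j\<close> and \<open>x\<close> after it.\<close>

lemma iter_diff:
  "iter n x - iter n p = (\<Sum>j<n. mul (iter (n - Suc j) ((f ^^ Suc j) x))
     (mul (A ((f ^^ j) x) - A ((f ^^ j) p)) (iter j p)))"
proof (induction n)
  case (Suc n)
  have shift: "mul (A ((f ^^ n) x)) (iter (n - Suc j) ((f ^^ Suc j) x))
      = iter (Suc n - Suc j) ((f ^^ Suc j) x)" if "j < n" for j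
  proof -
    have "Suc n - Suc j = Suc (n - Suc j)" using that by simp
    moreover have "(f ^^ (n - Suc j)) ((f ^^ Suc j) x) = (f ^^ n) x"
      using that by (metis Suc_leI comp_apply funpow_add le_add_diff_inverse2)
    ultimately show ?thesis by simp
  qed
  have "iter (Suc n) x - iter (Suc n) p
      = mul (A ((f ^^ n) x)) (iter n x - iter n p) + mul (A ((f ^^ n) x) - A ((f ^^ n) p)) (iter n p)"
    by (simp add: diff_left diff_right)
  also have "mul (A ((f ^^ n) x)) (iter n x - iter n p)
      = (\<Sum>j<n. mul (iter (Suc n - Suc j) ((f ^^ Suc j) x))
          (mul (A ((f ^^ j) x) - A ((f ^^ j) p)) (iter j p)))"
    unfolding Suc sum_right by (intro sum.cong refl) (metis mul_assoc shift lessThan_iff)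
  finally show ?case by (simp add: mul_e)
qed simp

lemma exp_growth_diff:
  "\<bar>exp (growth n x) - exp (growth n p)\<bar> \<le> (\<Sum>j<n. exp (growth (n - Suc j) ((f ^^ Suc j) x)) *
     norm (A ((f ^^ j) x) - A ((f ^^ j) p)) * exp (growth j p))"
proof (cases "norm e = 1")
  case True
  have "\<bar>norm (iter n x) - norm (iter n p)\<bar> \<le> norm (iter n x - iter n p)"
    by (rule norm_triangle_ineq3)
  also have "\<dots> \<le> (\<Sum>j<n. norm (iter (n - Suc j) ((f ^^ Suc j) x)) *
      norm (A ((f ^^ j) x) - A ((f ^^ j) p)) * norm (iter j p))"
    unfolding iter_diff
  proof (rule sum_norm_le)
    fix j
    show "norm (mul (iter (n - Suc j) ((f ^^ Suc j) x))
        (mul (A ((f ^^ j) x) - A ((f ^^ j) p)) (iter j p)))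
      \<le> norm (iter (n - Suc j) ((f ^^ Suc j) x)) *
        norm (A ((f ^^ j) x) - A ((f ^^ j) p)) * norm (iter j p)"
      unfolding mult.assoc
      by (rule order_trans[OF norm_mul]) (intro mult_left_mono norm_mul norm_ge_zero)
  qed
  finally show ?thesis by (simp only: exp_growth[OF True])
next
  case False
  then show ?thesis by (simp add: growth_trivial sum_nonneg del: funpow.simps)
qed

text \<open>The bound on the leading terms replaces the missing upper bound for \<open>growth (n - j)\<close> in terms of
  \<open>growth n\<close>: it makes the telescoped error a fraction of \<open>exp (growth n x)\<close> itself.\<close>

lemma shadowing:
  assumes tempered: "\<And>j m. growth m ((f ^^ j) x) \<le> (l + \<eta>) * real m + \<eta> * real j + K"
    and "0 \<le> K" "0 < \<eta>" "3 * \<eta> < \<beta>"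
  obtains E where "0 < E"
    and "\<And>n p. \<lbrakk>\<And>j. j < n \<Longrightarrow> norm (A ((f ^^ j) x) - A ((f ^^ j) p)) \<le> E * exp (- \<beta> * real j);
      \<And>i. i \<le> n \<Longrightarrow> growth (n - i) ((f ^^ i) x) + (l - 2 * \<eta>) * real i \<le> growth n x + K\<rbrakk>
      \<Longrightarrow> \<bar>growth n p - l * real n\<bar> \<le> 2 * \<eta> * real n + K + ln 2"
proof -
  \<comment> \<open>The ratio of the telescoped terms: \<open>l + \<eta>\<close> from the bound
    along \<open>p\<close>, minus \<open>l - 2 * \<eta>\<close> from the leading inequality, minus
    the decay \<beta>. The first sum has the better exponent \<open>\<eta> - \<beta>\<close> and is
    weakened to the same ratio.\<close>
  define q where "q = exp (3 * \<eta> - \<beta>)"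
  have q: "0 < q" "q < 1" using assms by (simp_all add: q_def)
  have geometric: "(\<Sum>j<i. q ^ j) \<le> 1 / (1 - q)" for i
    using q by (simp add: sum_gp_strict field_simps)
  \<comment> \<open>Chosen so that the second geometric sum is exactly half of
    \<open>exp (growth n x)\<close>; the first is then also at most half of its main term.\<close>
  define E where "E = (1 - q) * exp (l - 2 * K - 2 * \<eta>) / 4"
  have "0 < E" using q by (simp add: E_def)
  moreover have "\<bar>growth n p - l * real n\<bar> \<le> 2 * \<eta> * real n + K + ln 2"
    if close: "\<And>j. j < n \<Longrightarrow> norm (A ((f ^^ j) x) - A ((f ^^ j) p)) \<le> E * exp (- \<beta> * real j)"
      and lead: "\<And>i. i \<le> n \<Longrightarrow>
        growth (n - i) ((f ^^ i) x) + (l - 2 * \<eta>) * real i \<le> growth n x + K"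
    for n p
  proof -
    \<comment> \<open>A bootstrap: the factor 2 assumed at earlier times returns as at most
      \<open>1 + 1 / 2\<close>.\<close>
    have upper: "exp (growth i p) \<le> 2 * exp (K + (l + \<eta>) * real i)" if "i \<le> n" for i
      using that
    proof (induction i rule: less_induct)
      case (less i)
      have term_le: "exp (growth (i - Suc j) ((f ^^ Suc j) x)) *
          norm (A ((f ^^ j) x) - A ((f ^^ j) p)) * exp (growth j p)
          \<le> exp (K + (l + \<eta>) * real i) * (2 * E * exp (K - l)) * q ^ j" if "j < i" for j
      proof -
        have "exp (growth (i - Suc j) ((f ^^ Suc j) x)) *
            norm (A ((f ^^ j) x) - A ((f ^^ j) p)) * exp (growth j p)
          \<le> exp ((l + \<eta>) * real (i - Suc j) + \<eta> * real (Suc j) + K) *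
            (E * exp (- \<beta> * real j)) * (2 * exp (K + (l + \<eta>) * real j))"
          using that less close[of j] tempered[of "i - Suc j" "Suc j"] \<open>0 < E\<close>
          by (intro mult_mono) (auto simp del: funpow.simps of_nat_Suc)
        also have "\<dots> = 2 * E * exp (((l + \<eta>) * real (i - Suc j) + \<eta> * real (Suc j) + K)
            + - \<beta> * real j + (K + (l + \<eta>) * real j))"
          by (simp only: exp_add mult_ac)
        also have "((l + \<eta>) * real (i - Suc j) + \<eta> * real (Suc j) + K)
            + - \<beta> * real j + (K + (l + \<eta>) * real j)
            = (K + (l + \<eta>) * real i) + (K - l) + real j * (\<eta> - \<beta>)"
          using that by (simp add: of_nat_diff algebra_simps)
        also have "2 * E * exp \<dots>
            \<le> 2 * E * exp ((K + (l + \<eta>) * real i) + (K - l) + real j * (3 * \<eta> - \<beta>))"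
          using \<open>0 < E\<close> \<open>0 < \<eta>\<close> by (simp add: mult_left_mono)
        also have "\<dots> = exp (K + (l + \<eta>) * real i) * (2 * E * exp (K - l)) * q ^ j"
          unfolding q_def exp_of_nat_mult[symmetric] by (simp only: exp_add mult_ac)
        finally show ?thesis .
      qed
      have "exp (growth i p) \<le> exp (growth i x) + (\<Sum>j<i. exp (growth (i - Suc j) ((f ^^ Suc j) x)) *
          norm (A ((f ^^ j) x) - A ((f ^^ j) p)) * exp (growth j p))"
        using exp_growth_diff[of i x p] by linarith
      also have "\<dots> \<le> exp (K + (l + \<eta>) * real i) +
          (\<Sum>j<i. exp (K + (l + \<eta>) * real i) * (2 * E * exp (K - l)) * q ^ j)"
        using tempered[of i 0] term_le by (intro add_mono sum_mono) auto
      also have "\<dots> = exp (K + (l + \<eta>) * real i) * (1 + (2 * E * exp (K - l)) * (\<Sum>j<i. q ^ j))"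
        by (simp add: sum_distrib_left algebra_simps)
      also have "\<dots> \<le> exp (K + (l + \<eta>) * real i) * (1 + (2 * E * exp (K - l)) * (1 / (1 - q)))"
        using geometric \<open>0 < E\<close> by (intro mult_left_mono add_left_mono) auto
      also have "(2 * E * exp (K - l)) * (1 / (1 - q)) = exp (- K - 2 * \<eta>) / 2"
      proof -
        have "exp (l - 2 * K - 2 * \<eta>) * exp (K - l) = exp (- K - 2 * \<eta>)"
          by (simp add: exp_add[symmetric])
        then show ?thesis using q by (simp add: E_def field_simps)
      qed
      also have "exp (K + (l + \<eta>) * real i) * (1 + exp (- K - 2 * \<eta>) / 2)
          \<le> exp (K + (l + \<eta>) * real i) * 2"
      proof (intro mult_left_mono)
        have "exp (- K - 2 * \<eta>) \<le> 1" using assms by simp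
        then show "1 + exp (- K - 2 * \<eta>) / 2 \<le> 2" by linarith
      qed simp
      finally show ?case by simp
    qed
    have term_le: "exp (growth (n - Suc j) ((f ^^ Suc j) x)) *
        norm (A ((f ^^ j) x) - A ((f ^^ j) p)) * exp (growth j p)
        \<le> exp (growth n x) * (2 * E * exp (2 * K - l + 2 * \<eta>)) * q ^ j" if "j < n" for j
    proof -
      have "growth (n - Suc j) ((f ^^ Suc j) x) \<le> growth n x + K - (l - 2 * \<eta>) * real (Suc j)"
        using lead[of "Suc j"] that by simp
      then have "exp (growth (n - Suc j) ((f ^^ Suc j) x)) *
          norm (A ((f ^^ j) x) - A ((f ^^ j) p)) * exp (growth j p)
        \<le> exp (growth n x + K - (l - 2 * \<eta>) * real (Suc j)) *
          (E * exp (- \<beta> * real j)) * (2 * exp (K + (l + \<eta>) * real j))"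
        using that close[of j] upper[of j] \<open>0 < E\<close>
        by (intro mult_mono) (auto simp del: funpow.simps of_nat_Suc)
      also have "\<dots> = 2 * E * exp ((growth n x + K - (l - 2 * \<eta>) * real (Suc j))
          + - \<beta> * real j + (K + (l + \<eta>) * real j))"
        by (simp only: exp_add mult_ac)
      also have "(growth n x + K - (l - 2 * \<eta>) * real (Suc j))
          + - \<beta> * real j + (K + (l + \<eta>) * real j)
          = growth n x + (2 * K - l + 2 * \<eta>) + real j * (3 * \<eta> - \<beta>)"
        by (simp add: algebra_simps)
      also have "2 * E * exp \<dots> = exp (growth n x) * (2 * E * exp (2 * K - l + 2 * \<eta>)) * q ^ j"
        unfolding q_def exp_of_nat_mult[symmetric] by (simp only: exp_add mult_ac)
      finally show ?thesis .
    qed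
    have "exp (growth n x) - exp (growth n p)
        \<le> (\<Sum>j<n. exp (growth (n - Suc j) ((f ^^ Suc j) x)) *
            norm (A ((f ^^ j) x) - A ((f ^^ j) p)) * exp (growth j p))"
      using exp_growth_diff[of n x p] by linarith
    also have "\<dots> \<le> (\<Sum>j<n. exp (growth n x) * (2 * E * exp (2 * K - l + 2 * \<eta>)) * q ^ j)"
      by (intro sum_mono term_le) simp
    also have "\<dots> = exp (growth n x) * (2 * E * exp (2 * K - l + 2 * \<eta>)) * (\<Sum>j<n. q ^ j)"
      by (simp add: sum_distrib_left)
    also have "\<dots> \<le> exp (growth n x) * (2 * E * exp (2 * K - l + 2 * \<eta>)) * (1 / (1 - q))"
      using geometric \<open>0 < E\<close> by (intro mult_left_mono) auto
    also have "\<dots> = exp (growth n x) / 2"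
    proof -
      have "exp (l - 2 * K - 2 * \<eta>) * exp (2 * K - l + 2 * \<eta>) = 1"
        by (simp add: exp_add[symmetric])
      then show ?thesis using q by (simp add: E_def field_simps)
    qed
    finally have "exp (growth n x) \<le> 2 * exp (growth n p)" by linarith
    then have "exp (growth n x) \<le> exp (ln 2 + growth n p)" by (simp add: exp_add)
    then have "growth n x \<le> ln 2 + growth n p" by simp
    \<comment> \<open>At \<open>i = n\<close> the leading inequality becomes a lower bound for
      \<open>growth n x\<close> itself.\<close>
    moreover have "(l - 2 * \<eta>) * real n \<le> growth n x + K"
      using lead[of n] by (simp add: growth_0)
    moreover have "exp (growth n p) \<le> exp (ln 2 + (K + (l + \<eta>) * real n))"
      using upper[of n] by (simp add: exp_add)
    then have "growth n p \<le> ln 2 + (K + (l + \<eta>) * real n)" by simp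
    moreover have "0 \<le> \<eta> * real n" using \<open>0 < \<eta>\<close> by simp
    ultimately show ?thesis by (simp add: abs_le_iff algebra_simps)
  qed
  ultimately show thesis by (rule that)
qed

end

text \<open>Measurability goes through continuity: the values may lie in a nonseparable space, where
  products of measurable maps need not be measurable.\<close>

lemma tame_growth:
  fixes M :: "'x::topological_space measure"
  assumes "bounded_cocycle mul e A B C" "ergodic_system M f" "sets M = sets borel"
    and cont: "continuous_on UNIV f" "continuous_on UNIV A"
  shows "ergodic_system.tame M f (bounded_cocycle.growth mul e f A) C"
proof -
  interpret bounded_cocycle mul e f A B C by fact
  interpret ergodic_system M f by fact
  have cont_pow: "continuous_on UNIV (f ^^ n)" for n
    by (induction n) (auto intro: continuous_on_compose2[OF cont(1)] simp: id_def comp_def)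
  have "continuous_on UNIV (iter n)" for n
    by (induction n) (auto intro!: continuous_on continuous_on_compose2[OF cont(2) cont_pow])
  then have "iter n \<in> borel_measurable M" for n
    using assms(3) by (metis borel_measurable_continuous_onI measurable_cong_sets)
  then have "growth n \<in> borel_measurable M" for n
    unfolding growth_def by measurable
  then show ?thesis
    by (intro tameI) (auto simp: growth_0 growth_subadd growth_first growth_last)
qed

section \<open>Periodic approximation\<close>

lemma hoelder_imp_continuous:
  fixes g :: "'x::metric_space \<Rightarrow> 'b::real_normed_vector"
  assumes "0 < r" "0 < \<alpha>"
    and hoelder: "\<And>x y. dist x y < r \<Longrightarrow> norm (g x - g y) \<le> L * dist x y powr \<alpha>"
  shows "continuous_on UNIV g"
proof -
  have "((\<lambda>y. g y - g x) \<longlongrightarrow> 0) (at x)" for x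
  proof (rule Lim_null_comparison)
    have "\<forall>\<^sub>F y in at x. dist y x < r"
      using \<open>0 < r\<close> by (auto simp: eventually_at)
    then show "\<forall>\<^sub>F y in at x. norm (g y - g x) \<le> L * dist y x powr \<alpha>"
      by eventually_elim (rule hoelder)
    have "((\<lambda>y. dist y x) \<longlongrightarrow> dist x x) (at x)"
      by (intro tendsto_intros)
    then have "((\<lambda>y. dist y x powr \<alpha>) \<longlongrightarrow> 0) (at x)"
      using \<open>0 < \<alpha>\<close> by (intro tendsto_zero_powrI[of _ _ _ \<alpha>]) auto
    then show "((\<lambda>y. L * dist y x powr \<alpha>) \<longlongrightarrow> 0) (at x)"
      by (rule tendsto_mult_right_zero)
  qed
  then show ?thesis
    by (simp add: continuous_on_def LIM_zero_iff)
qed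

text \<open>Two cocycles are treated at once because the same periodic point has to serve the
  products and their inverses.\<close>

theorem periodic_approximation:
  fixes M :: "'x::metric_space measure" and f :: "'x \<Rightarrow> 'x"
    and mul\<^sub>1 :: "'b::real_normed_vector \<Rightarrow> 'b \<Rightarrow> 'b" and mul\<^sub>2 :: "'c::real_normed_vector \<Rightarrow> 'c \<Rightarrow> 'c"
  assumes system: "ergodic_system M f" and sets: "sets M = sets borel"
    and sep: "separable_space (euclidean :: 'x topology)"
    and cont: "continuous_on UNIV f" and closing: "closing_property f"
    and cocycle\<^sub>1: "bounded_cocycle mul\<^sub>1 e\<^sub>1 A\<^sub>1 B\<^sub>1 C"
    and cocycle\<^sub>2: "bounded_cocycle mul\<^sub>2 e\<^sub>2 A\<^sub>2 B\<^sub>2 C"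
    and pos: "0 < \<alpha>" "0 < L" "0 < r"
    and hoelder\<^sub>1: "\<And>x y. dist x y < r \<Longrightarrow> norm (A\<^sub>1 x - A\<^sub>1 y) \<le> L * dist x y powr \<alpha>"
    and hoelder\<^sub>2: "\<And>x y. dist x y < r \<Longrightarrow> norm (A\<^sub>2 x - A\<^sub>2 y) \<le> L * dist x y powr \<alpha>"
    and "0 < \<epsilon>"
  shows "\<exists>k>N. \<exists>p. (f ^^ k) p = p \<and>
    \<bar>ergodic_system.rate M (bounded_cocycle.growth mul\<^sub>1 e\<^sub>1 f A\<^sub>1)
      - bounded_cocycle.growth mul\<^sub>1 e\<^sub>1 f A\<^sub>1 k p / real k\<bar> < \<epsilon> \<and>
    \<bar>ergodic_system.rate M (bounded_cocycle.growth mul\<^sub>2 e\<^sub>2 f A\<^sub>2)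
      - bounded_cocycle.growth mul\<^sub>2 e\<^sub>2 f A\<^sub>2 k p / real k\<bar> < \<epsilon>"
proof -
  interpret ergodic_system M f by fact
  interpret P: bounded_cocycle mul\<^sub>1 e\<^sub>1 f A\<^sub>1 B\<^sub>1 C by fact
  interpret Q: bounded_cocycle mul\<^sub>2 e\<^sub>2 f A\<^sub>2 B\<^sub>2 C by fact
  have "continuous_on UNIV A\<^sub>1"
    using hoelder\<^sub>1 by (rule hoelder_imp_continuous[OF pos(3,1)])
  note tame_P = tame_growth[OF cocycle\<^sub>1 system sets cont this]
  have "continuous_on UNIV A\<^sub>2"
    using hoelder\<^sub>2 by (rule hoelder_imp_continuous[OF pos(3,1)])
  note tame_Q = tame_growth[OF cocycle\<^sub>2 system sets cont this]
  define l\<^sub>1 where "l\<^sub>1 = rate P.growth"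
  define l\<^sub>2 where "l\<^sub>2 = rate Q.growth"
  \<comment> \<open>Leading times of the sum are, by subadditivity of the other summand, leading times of both summands.\<close>
  define c where "c n x = P.growth n x + Q.growth n x" for n x
  have tame_c: "tame c (2 * C)"
  proof (rule tameI)
    show "c n \<in> borel_measurable M" for n
      unfolding c_def using tame_measurable[OF tame_P] tame_measurable[OF tame_Q] by measurable
  next
    fix n x
    show "\<bar>c (Suc n) x - c n (f x)\<bar> \<le> 2 * C"
      using P.growth_first[of n x] Q.growth_first[of n x] by (simp add: c_def abs_le_iff)
    show "\<bar>c (Suc n) x - c n x\<bar> \<le> 2 * C"
      using P.growth_last[of n x] Q.growth_last[of n x] by (simp add: c_def abs_le_iff)
  next
    fix m n x
    show "c (m + n) x \<le> c m x + c n ((f ^^ m) x)"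
      using P.growth_subadd[of m n x] Q.growth_subadd[of m n x] by (simp add: c_def)
  qed (simp add: c_def P.growth_0 Q.growth_0)
  have int_c: "(l\<^sub>1 + l\<^sub>2) * real n \<le> (\<integral>x. c n x \<partial>M)" for n
    using rate_le[OF tame_P, of n] rate_le[OF tame_Q, of n]
      tame_integrable[OF tame_P, of n] tame_integrable[OF tame_Q, of n]
    by (simp add: c_def l\<^sub>1_def l\<^sub>2_def algebra_simps)

  obtain D \<gamma> \<delta>\<^sub>0 where closing_pos: "0 < D" "0 < \<gamma>" "0 < \<delta>\<^sub>0"
    and close: "\<And>x k. \<lbrakk>0 < k; dist x ((f ^^ k) x) < \<delta>\<^sub>0\<rbrakk> \<Longrightarrow>
        \<exists>p. (f ^^ k) p = p \<and> (\<forall>i\<le>k. dist ((f ^^ i) x) ((f ^^ i) p)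
          \<le> D * dist x ((f ^^ k) x) * exp (- \<gamma> * real (min i (k - i))))"
    using closing unfolding closing_property_def by blast

  define C' where "C' = C + \<bar>l\<^sub>1\<bar> + \<bar>l\<^sub>2\<bar> + 1"
  have "0 < C'" using P.C_nonneg by (simp add: C'_def)
  \<comment> \<open>The factor 12 makes the cost \<open>3 * C' * s * n\<close> of the steps after
    \<open>n\<close> at most a quarter of \<open>\<epsilon> * n\<close>; the cap 1 gives
    \<open>s * s \<le> s\<close>.\<close>
  define s where "s = min 1 (\<epsilon> / (12 * C'))"
  have s: "0 < s" "s \<le> 1" using \<open>0 < \<epsilon>\<close> \<open>0 < C'\<close> by (simp_all add: s_def)
  have "s \<le> \<epsilon> / (12 * C')" by (simp add: s_def)
  then have C's: "3 * C' * s \<le> \<epsilon> / 4" using \<open>0 < C'\<close> by (simp add: field_simps)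
  \<comment> \<open>Orbit distances decay at rate \<open>\<gamma> * s\<close> in \<open>j\<close>;
    the Hoelder exponent turns this into the rate for the generators.\<close>
  define \<beta> where "\<beta> = \<gamma> * s * \<alpha>"
  define \<eta> where "\<eta> = min (\<beta> / 4) (\<epsilon> / 8)"
  have "0 < \<beta>" using closing_pos s pos by (simp add: \<beta>_def)
  then have \<eta>: "0 < \<eta>" "3 * \<eta> < \<beta>" "2 * \<eta> \<le> \<epsilon> / 4"
    using \<open>0 < \<epsilon>\<close> by (auto simp: \<eta>_def min_def)

  define lead where
    "lead x m \<longleftrightarrow> (\<forall>i\<le>m. c (m - i) ((f ^^ i) x) + (l\<^sub>1 + l\<^sub>2 - \<eta>) * real i \<le> c m x)" for x m
  have not_AE: "\<not> (AE x in M. \<forall>\<^sub>F m in sequentially. \<not> lead x m)"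
    unfolding lead_def by (rule karlsson_margulis[OF tame_c int_c \<eta>(1)])
  define good where "good x \<longleftrightarrow>
      (\<forall>\<epsilon>>0. \<exists>K. \<forall>j m. P.growth m ((f ^^ j) x) \<le> (l\<^sub>1 + \<epsilon>) * real m + \<epsilon> * real j + K) \<and>
      (\<forall>\<epsilon>>0. \<exists>K. \<forall>j m. Q.growth m ((f ^^ j) x) \<le> (l\<^sub>2 + \<epsilon>) * real m + \<epsilon> * real j + K) \<and>
      (\<forall>r>0. \<forall>s>0. \<forall>\<^sub>F n in sequentially. \<exists>k\<ge>n. real k \<le> (1 + s) * real n \<and> dist x ((f ^^ k) x) < r)"
    for x
  have AE_good: "AE x in M. good x"
    using tame_tempered[OF tame_P] tame_tempered[OF tame_Q] recurrence_in_window[OF system sets sep]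
    unfolding l\<^sub>1_def[symmetric] l\<^sub>2_def[symmetric]
    by eventually_elim (simp add: good_def)
  \<comment> \<open>Frequent leading times are known only as the failure of an almost everywhere
    statement, so the point is found by contradiction.\<close>
  have "\<exists>x. good x \<and> (\<exists>\<^sub>F m in sequentially. lead x m)"
  proof (rule ccontr)
    assume "\<not> ?thesis"
    then have never: "\<forall>\<^sub>F m in sequentially. \<not> lead x m" if "good x" for x
      using that by (simp add: not_frequently)
    have "AE x in M. \<forall>\<^sub>F m in sequentially. \<not> lead x m"
      using AE_good by (rule eventually_mono) (rule never)
    with not_AE show False by contradiction
  qed
  then obtain x where "good x" and freq: "\<exists>\<^sub>F m in sequentially. lead x m" by blast
  have returns: "\<forall>\<^sub>F n in sequentially. \<exists>k\<ge>n. real k \<le> (1 + s) * real n \<and> dist x ((f ^^ k) x) < r"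
    if "0 < r" "0 < s" for r s
    using \<open>good x\<close> that by (simp add: good_def)
  from \<open>good x\<close> \<eta>(1) obtain K\<^sub>1 K\<^sub>2 where
    K\<^sub>1: "\<And>j m. P.growth m ((f ^^ j) x) \<le> (l\<^sub>1 + \<eta>) * real m + \<eta> * real j + K\<^sub>1" and
    K\<^sub>2: "\<And>j m. Q.growth m ((f ^^ j) x) \<le> (l\<^sub>2 + \<eta>) * real m + \<eta> * real j + K\<^sub>2"
    unfolding good_def by blast
  define K where "K = max 0 (max K\<^sub>1 K\<^sub>2)"
  have K: "0 \<le> K" "\<And>j m. P.growth m ((f ^^ j) x) \<le> (l\<^sub>1 + \<eta>) * real m + \<eta> * real j + K"
      "\<And>j m. Q.growth m ((f ^^ j) x) \<le> (l\<^sub>2 + \<eta>) * real m + \<eta> * real j + K"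
    using order_trans[OF K\<^sub>1] order_trans[OF K\<^sub>2] by (simp_all add: K_def)

  obtain E\<^sub>1 where "0 < E\<^sub>1" and shadow\<^sub>1:
    "\<And>n p. \<lbrakk>\<And>j. j < n \<Longrightarrow> norm (A\<^sub>1 ((f ^^ j) x) - A\<^sub>1 ((f ^^ j) p)) \<le> E\<^sub>1 * exp (- \<beta> * real j);
      \<And>i. i \<le> n \<Longrightarrow> P.growth (n - i) ((f ^^ i) x) + (l\<^sub>1 - 2 * \<eta>) * real i \<le> P.growth n x + K\<rbrakk>
      \<Longrightarrow> \<bar>P.growth n p - l\<^sub>1 * real n\<bar> \<le> 2 * \<eta> * real n + K + ln 2"
    using P.shadowing[OF K(2) K(1) \<eta>(1,2)] by blast
  obtain E\<^sub>2 where "0 < E\<^sub>2" and shadow\<^sub>2: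
    "\<And>n p. \<lbrakk>\<And>j. j < n \<Longrightarrow> norm (A\<^sub>2 ((f ^^ j) x) - A\<^sub>2 ((f ^^ j) p)) \<le> E\<^sub>2 * exp (- \<beta> * real j);
      \<And>i. i \<le> n \<Longrightarrow> Q.growth (n - i) ((f ^^ i) x) + (l\<^sub>2 - 2 * \<eta>) * real i \<le> Q.growth n x + K\<rbrakk>
      \<Longrightarrow> \<bar>Q.growth n p - l\<^sub>2 * real n\<bar> \<le> 2 * \<eta> * real n + K + ln 2"
    using Q.shadowing[OF K(3) K(1) \<eta>(1,2)] by blast
  define E where "E = min E\<^sub>1 E\<^sub>2"
  have "0 < E" using \<open>0 < E\<^sub>1\<close> \<open>0 < E\<^sub>2\<close> by (simp add: E_def)
  \<comment> \<open>A distance within the Hoelder range at which the Hoelder bound is at most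
    \<open>E\<close>; \<delta> is the return distance for which the closing property starts from
    \<open>y\<close>.\<close>
  define y where "y = min (r / 2) ((E / L) powr (1 / \<alpha>))"
  have y: "0 < y" "y < r" using pos \<open>0 < E\<close> by (auto simp: y_def)
  have "y powr \<alpha> \<le> ((E / L) powr (1 / \<alpha>)) powr \<alpha>"
    using pos y by (intro powr_mono2) (auto simp: y_def)
  also have "\<dots> = E / L" using pos \<open>0 < E\<close> by (simp add: powr_powr)
  finally have y_E: "L * y powr \<alpha> \<le> E" using pos by (simp add: field_simps)
  define \<delta> where "\<delta> = min \<delta>\<^sub>0 (y / D)"
  have \<delta>: "0 < \<delta>" "\<delta> \<le> \<delta>\<^sub>0" "D * \<delta> \<le> y"
    using closing_pos y by (auto simp: \<delta>_def min_def field_simps)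

  obtain n\<^sub>1 where n\<^sub>1: "\<And>n. n \<ge> n\<^sub>1 \<Longrightarrow> \<exists>k\<ge>n. real k \<le> (1 + s) * real n \<and> dist x ((f ^^ k) x) < \<delta>"
    using returns[OF \<delta>(1) s(1)] by (auto simp: eventually_sequentially)
  have "0 < \<epsilon> / 4" using \<open>0 < \<epsilon>\<close> by simp
  from reals_Archimedean3[OF this] obtain n\<^sub>2 where n\<^sub>2: "K + ln 2 + 2 * C' < real n\<^sub>2 * (\<epsilon> / 4)"
    by blast
  obtain n where n: "n \<ge> Suc (N + n\<^sub>1 + n\<^sub>2)" and "lead x n"
    using freq unfolding frequently_sequentially by blast
  \<comment> \<open>Opening the return window at \<open>n'\<close> instead of \<open>n\<close>
    guarantees the gap \<open>k - n \<ge> s * n\<close>; the two factors \<open>1 + s\<close> and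
    the rounding give \<open>3 * s * n + 2\<close> above.\<close>
  define n' where "n' = nat \<lceil>(1 + s) * real n\<rceil>"
  have n': "(1 + s) * real n \<le> real n'" "real n' \<le> (1 + s) * real n + 1"
    using s unfolding n'_def by (auto simp: of_nat_ceiling) 
  have "real n \<le> (1 + s) * real n" using s by (simp add: algebra_simps)
  then have "n \<le> n'" using n' by linarith
  then obtain k where k: "n' \<le> k" "real k \<le> (1 + s) * real n'" "dist x ((f ^^ k) x) < \<delta>"
    using n\<^sub>1[of n'] n by auto
  have "n \<le> k" "0 < k" "N < k" using k \<open>n \<le> n'\<close> n by auto
  have far: "s * real n \<le> real k - real n"
    using n' k by (simp add: algebra_simps)
  have near: "real k - real n \<le> 3 * s * real n + 2"
  proof -
    have "(1 + s) * real n' \<le> (1 + s) * ((1 + s) * real n + 1)"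
      using n' s by (intro mult_left_mono) auto
    also have "\<dots> = real n + 2 * s * real n + s * (s * real n) + 1 + s"
      by (simp add: algebra_simps)
    also have "s * (s * real n) \<le> 1 * (s * real n)"
      using s by (intro mult_right_mono) auto
    finally show ?thesis using k s by linarith
  qed
  obtain p where p: "(f ^^ k) p = p"
    and orbit: "\<And>i. i \<le> k \<Longrightarrow> dist ((f ^^ i) x) ((f ^^ i) p)
      \<le> D * dist x ((f ^^ k) x) * exp (- \<gamma> * real (min i (k - i)))"
    using close[OF \<open>0 < k\<close>, of x] k \<delta> by auto
  have orbit_close: "dist ((f ^^ j) x) ((f ^^ j) p) < r \<and>
      L * dist ((f ^^ j) x) ((f ^^ j) p) powr \<alpha> \<le> E * exp (- \<beta> * real j)" if "j < n" for j
  proof -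
    have "s * real j \<le> s * real n" using that s by (intro mult_left_mono) auto
    then have "s * real j \<le> real (k - j)"
      using far that \<open>n \<le> k\<close> by (simp add: of_nat_diff)
    moreover have "s * real j \<le> real j" using s by (simp add: mult_left_le_one_le)
    \<comment> \<open>Both ends of the period are far in proportion to \<open>j\<close>:
      \<open>j \<ge> s * j\<close> on the left, \<open>k - j \<ge> s * n \<ge> s * j\<close> on the
      right.\<close>
    ultimately have sj: "s * real j \<le> real (min j (k - j))" by (simp add: min_def)
    have "dist ((f ^^ j) x) ((f ^^ j) p) \<le> D * dist x ((f ^^ k) x) * exp (- \<gamma> * real (min j (k - j)))"
      using orbit that \<open>n \<le> k\<close> by simp
    also have "\<dots> \<le> y * exp (- \<gamma> * s * real j)"
    proof (intro mult_mono)
      have "D * dist x ((f ^^ k) x) \<le> D * \<delta>"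
        using k closing_pos by (intro mult_left_mono) auto
      then show "D * dist x ((f ^^ k) x) \<le> y" using \<delta> by linarith
      show "exp (- \<gamma> * real (min j (k - j))) \<le> exp (- \<gamma> * s * real j)"
        using mult_left_mono[OF sj, of \<gamma>] closing_pos by (simp add: mult.assoc)
    qed (use y in auto)
    finally have d: "dist ((f ^^ j) x) ((f ^^ j) p) \<le> y * exp (- \<gamma> * s * real j)" .
    have "exp (- \<gamma> * s * real j) \<le> 1" using closing_pos s by simp
    then have "y * exp (- \<gamma> * s * real j) \<le> y" using y by (simp add: mult_left_le)
    then have "dist ((f ^^ j) x) ((f ^^ j) p) < r" using d y by linarith
    moreover have "L * dist ((f ^^ j) x) ((f ^^ j) p) powr \<alpha> \<le> E * exp (- \<beta> * real j)"
    proof -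
      have "dist ((f ^^ j) x) ((f ^^ j) p) powr \<alpha> \<le> (y * exp (- \<gamma> * s * real j)) powr \<alpha>"
        using d pos by (intro powr_mono2) auto
      also have "\<dots> = y powr \<alpha> * exp (- \<beta> * real j)"
        using y by (simp add: powr_mult exp_powr_real \<beta>_def algebra_simps)
      finally have "L * dist ((f ^^ j) x) ((f ^^ j) p) powr \<alpha> \<le> (L * y powr \<alpha>) * exp (- \<beta> * real j)"
        using pos by (simp add: mult.assoc)
      also have "\<dots> \<le> E * exp (- \<beta> * real j)"
        using y_E by (intro mult_right_mono) auto
      finally show ?thesis .
    qed
    ultimately show ?thesis by blast
  qed
  \<comment> \<open>One \<eta> is lost in the leading inequality of the sum, the other in the
    tempered bound for the summand that is removed.\<close>
  have "P.growth (n - i) ((f ^^ i) x) + (l\<^sub>1 - 2 * \<eta>) * real i \<le> P.growth n x + K \<and>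
      Q.growth (n - i) ((f ^^ i) x) + (l\<^sub>2 - 2 * \<eta>) * real i \<le> Q.growth n x + K" if "i \<le> n" for i
  proof -
    have "P.growth n x \<le> P.growth i x + P.growth (n - i) ((f ^^ i) x)"
      "Q.growth n x \<le> Q.growth i x + Q.growth (n - i) ((f ^^ i) x)"
      using P.growth_subadd[of i "n - i" x] Q.growth_subadd[of i "n - i" x] that by simp_all
    moreover have "P.growth i x \<le> (l\<^sub>1 + \<eta>) * real i + K" "Q.growth i x \<le> (l\<^sub>2 + \<eta>) * real i + K"
      using K(2)[of i 0] K(3)[of i 0] by simp_all
    moreover have "c (n - i) ((f ^^ i) x) + (l\<^sub>1 + l\<^sub>2 - \<eta>) * real i \<le> c n x"
      using \<open>lead x n\<close> that by (simp add: lead_def)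
    ultimately show ?thesis
      by (simp add: c_def algebra_simps)
  qed
  moreover have "norm (A\<^sub>1 ((f ^^ j) x) - A\<^sub>1 ((f ^^ j) p)) \<le> E\<^sub>1 * exp (- \<beta> * real j)"
      "norm (A\<^sub>2 ((f ^^ j) x) - A\<^sub>2 ((f ^^ j) p)) \<le> E\<^sub>2 * exp (- \<beta> * real j)" if "j < n" for j
  proof -
    have "E * exp (- \<beta> * real j) \<le> E\<^sub>1 * exp (- \<beta> * real j)"
      "E * exp (- \<beta> * real j) \<le> E\<^sub>2 * exp (- \<beta> * real j)"
      by (auto simp: E_def intro!: mult_right_mono)
    then show "norm (A\<^sub>1 ((f ^^ j) x) - A\<^sub>1 ((f ^^ j) p)) \<le> E\<^sub>1 * exp (- \<beta> * real j)"
      "norm (A\<^sub>2 ((f ^^ j) x) - A\<^sub>2 ((f ^^ j) p)) \<le> E\<^sub>2 * exp (- \<beta> * real j)"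
      using orbit_close[OF that] hoelder\<^sub>1 hoelder\<^sub>2 by (meson order_trans)+
  qed
  ultimately have
    at_n: "\<bar>P.growth n p - l\<^sub>1 * real n\<bar> \<le> 2 * \<eta> * real n + K + ln 2"
      "\<bar>Q.growth n p - l\<^sub>2 * real n\<bar> \<le> 2 * \<eta> * real n + K + ln 2"
    using shadow\<^sub>1[of n p] shadow\<^sub>2[of n p] by blast+
  have transfer: "\<bar>l - g k / real k\<bar> < \<epsilon>"
    if at_n: "\<bar>g n - l * real n\<bar> \<le> 2 * \<eta> * real n + K + ln 2"
      and lipschitz: "\<bar>g k - g n\<bar> \<le> C * (real k - real n)" and l: "C + \<bar>l\<bar> \<le> C'"
    for g :: "nat \<Rightarrow> real" and l
  proof -
    have "l * real k - l * real n = l * (real k - real n)" by (simp add: algebra_simps)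
    then have "\<bar>l * real k - l * real n\<bar> = \<bar>l\<bar> * (real k - real n)"
      using \<open>n \<le> k\<close> by (simp add: abs_mult)
    then have "\<bar>l * real k - g k\<bar>
        \<le> 2 * \<eta> * real n + K + ln 2 + (C + \<bar>l\<bar>) * (real k - real n)"
      using at_n lipschitz by (simp add: algebra_simps)
    also have "\<dots> \<le> 2 * \<eta> * real n + K + ln 2 + C' * (3 * s * real n + 2)"
      using l near \<open>n \<le> k\<close> \<open>0 < C'\<close> by (intro add_left_mono mult_mono) auto
    also have "\<dots> = 2 * \<eta> * real n + (3 * C' * s) * real n + (K + ln 2 + 2 * C')"
      by (simp add: algebra_simps)
    \<comment> \<open>Each of the three errors gets a quarter of \<open>\<epsilon> * n\<close>: the
      shadowing error by the choice of \<eta>, the steps after \<open>n\<close> by that of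
      \<open>s\<close>, the constants by that of \<open>n\<^sub>2\<close>.\<close>
    also have "\<dots> < \<epsilon> / 4 * real n + \<epsilon> / 4 * real n + \<epsilon> / 4 * real n"
    proof (intro add_le_less_mono add_mono mult_right_mono \<eta>(3) C's)
      have "real n\<^sub>2 * (\<epsilon> / 4) \<le> real n * (\<epsilon> / 4)"
        using n \<open>0 < \<epsilon>\<close> by (intro mult_right_mono) auto
      then show "K + ln 2 + 2 * C' < \<epsilon> / 4 * real n"
        using n\<^sub>2 by (simp add: mult.commute)
    qed auto
    also have "\<dots> \<le> \<epsilon> * real n" using \<open>0 < \<epsilon>\<close> by simp
    also have "\<dots> \<le> \<epsilon> * real k"
      using \<open>0 < \<epsilon>\<close> \<open>n \<le> k\<close> by (intro mult_left_mono) auto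
    finally have "\<bar>l * real k - g k\<bar> < \<epsilon> * real k" .
    moreover have "l - g k / real k = (l * real k - g k) / real k"
      using \<open>0 < k\<close> by (simp add: field_simps)
    ultimately show ?thesis
      using \<open>0 < k\<close> by (simp add: abs_divide divide_less_eq)
  qed
  have "\<bar>l\<^sub>1 - P.growth k p / real k\<bar> < \<epsilon>" "\<bar>l\<^sub>2 - Q.growth k p / real k\<bar> < \<epsilon>"
    by (rule transfer[OF at_n(1) P.growth_lipschitz[OF \<open>n \<le> k\<close>]], simp add: C'_def)
       (rule transfer[OF at_n(2) Q.growth_lipschitz[OF \<open>n \<le> k\<close>]], simp add: C'_def)
  then show ?thesis
    unfolding l\<^sub>1_def l\<^sub>2_def using p \<open>N < k\<close> by blast
qed

section \<open>Operator inverses, Lyapunov exponents and conclusion\<close>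

text \<open>In a probability space an almost everywhere statement holds somewhere, so two almost
  everywhere limits agree.\<close>

lemma (in prob_space) THE_AE_limit_eq:
  fixes u :: "'a \<Rightarrow> nat \<Rightarrow> real"
  assumes lim: "AE x in M. u x \<longlonglongrightarrow> l"
  shows "(THE l. AE x in M. u x \<longlonglongrightarrow> l) = l"
proof (rule the_equality)
  show "AE x in M. u x \<longlonglongrightarrow> l" by (rule lim)
next
  fix l' assume "AE x in M. u x \<longlonglongrightarrow> l'"
  then have "AE x in M. l' = l"
    using lim by eventually_elim (rule LIMSEQ_unique)
  then show "l' = l" by simp
qed

lemma blinfun_compose_monoid:
  fixes R S T :: "'v::real_normed_vector \<Rightarrow>\<^sub>L 'v"
  shows blinfun_compose_assoc: "(R o\<^sub>L S) o\<^sub>L T = R o\<^sub>L (S o\<^sub>L T)"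
    and blinfun_compose_id_right: "T o\<^sub>L id_blinfun = T"
    and blinfun_compose_id_left: "id_blinfun o\<^sub>L T = T"
  by (auto intro: blinfun_eqI)

lemma blinfun_inv_eqI:
  fixes S T :: "'v::real_normed_vector \<Rightarrow>\<^sub>L 'v"
  assumes "S o\<^sub>L T = id_blinfun" "T o\<^sub>L S = id_blinfun"
  shows "blinfun_inv T = S"
  unfolding blinfun_inv_def
proof (rule the_equality)
  fix S' assume "S' o\<^sub>L T = id_blinfun \<and> T o\<^sub>L S' = id_blinfun"
  then show "S' = S"
    by (metis assms(2) blinfun_compose_monoid)
qed (use assms in blast)

lemma GL_inverse:
  assumes "T \<in> GL"
  shows "blinfun_inv T o\<^sub>L T = id_blinfun" "T o\<^sub>L blinfun_inv T = id_blinfun"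
  using assms blinfun_inv_eqI unfolding GL_def by blast+

theorem theorem1p4:
  fixes f :: "'x::metric_space \<Rightarrow> 'x"
    and \<mu> :: "'x measure"
    and A :: "'x \<Rightarrow> ('v::banach \<Rightarrow>\<^sub>L 'v)"
  assumes "separable_space (euclidean :: 'x topology)"
    and "homeomorphism UNIV UNIV f (inv f)"
    and "closing_property f"
    and "prob_space \<mu>" and "sets \<mu> = sets borel"
    and "measure_invariant f \<mu>" and "measure_ergodic f \<mu>"
    and "range A \<subseteq> GL"
    and "bounded_generator A"
    and "hoelder_generator A"
  shows "\<forall>\<epsilon>>0.
     (\<exists>k::nat. k > 0 \<and> (\<exists>p. (f ^^ k) p = p \<and>
        \<bar>upper_lyapunov \<mu> f A - 1 / real k * ln (norm (cocycle f A p (int k)))\<bar> < \<epsilon> \<and>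
        \<bar>lower_lyapunov \<mu> f A
           - 1 / real k * ln (inverse (norm (blinfun_inv (cocycle f A p (int k)))))\<bar> < \<epsilon>)) \<and>
     (\<forall>N::nat. N > 0 \<longrightarrow> (\<exists>k. k > N \<and> (\<exists>p. (f ^^ k) p = p \<and>
        \<bar>upper_lyapunov \<mu> f A - 1 / real k * ln (norm (cocycle f A p (int k)))\<bar> < \<epsilon> \<and>
        \<bar>lower_lyapunov \<mu> f A
           - 1 / real k * ln (inverse (norm (blinfun_inv (cocycle f A p (int k)))))\<bar> < \<epsilon>)))"
proof -
  have system: "ergodic_system \<mu> f"
    using assms(4-7) sets_eq_imp_space_eq[OF assms(5)]
    by (simp add: ergodic_system_def ergodic_system_axioms_def)
  interpret ergodic_system \<mu> f by fact
  have cont: "continuous_on UNIV f"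
    using assms(2) by (simp add: homeomorphism_def)
  have inverses: "blinfun_inv (A x) o\<^sub>L A x = id_blinfun" "A x o\<^sub>L blinfun_inv (A x) = id_blinfun" for x
    using GL_inverse[of "A x"] assms(8) by auto
  obtain C\<^sub>0 where C\<^sub>0: "\<And>x. norm (A x) \<le> C\<^sub>0" "\<And>x. norm (blinfun_inv (A x)) \<le> C\<^sub>0"
    using assms(9) unfolding bounded_generator_def by blast
  \<comment> \<open>The maximum with 1 makes \<open>C\<close> nonnegative and the logarithm that of
    a positive number.\<close>
  define C where "C = ln (max 1 C\<^sub>0)"
  have C: "0 \<le> C" "norm (A x) \<le> exp C" "norm (blinfun_inv (A x)) \<le> exp C" for x
    using C\<^sub>0[of x] by (auto simp: C_def max_def)
  have cocycle_A: "bounded_cocycle (o\<^sub>L) id_blinfun A (\<lambda>x. blinfun_inv (A x)) C"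
    by (intro bounded_cocycle.intro bounded_bilinear_blinfun_compose bounded_cocycle_axioms.intro
        blinfun_compose_monoid norm_blinfun_compose norm_blinfun_id_le inverses C)
  interpret P: bounded_cocycle "(o\<^sub>L)" id_blinfun f A "\<lambda>x. blinfun_inv (A x)" C by fact
  have cocycle_inv: "bounded_cocycle (\<lambda>S T. T o\<^sub>L S) id_blinfun (\<lambda>x. blinfun_inv (A x)) A C"
  proof (intro bounded_cocycle.intro bounded_cocycle_axioms.intro inverses C blinfun_compose_monoid
      norm_blinfun_id_le)
    show "bounded_bilinear (\<lambda>S T :: 'v \<Rightarrow>\<^sub>L 'v. T o\<^sub>L S)"
      by (rule bounded_bilinear.flip[OF bounded_bilinear_blinfun_compose])
    show "norm (T o\<^sub>L S) \<le> norm S * norm T" for S T :: "'v \<Rightarrow>\<^sub>L 'v"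
      using norm_blinfun_compose[of T S] by (simp add: mult.commute)
  qed (simp add: blinfun_compose_assoc)
  interpret Q: bounded_cocycle "\<lambda>S T. T o\<^sub>L S" id_blinfun f "\<lambda>x. blinfun_inv (A x)" A C by fact
  have P_iter: "cocycle f A x (int n) = P.iter n x" for n x
    by (simp, induction n) simp_all
  have Q_iter: "blinfun_inv (cocycle f A x (int n)) = Q.iter n x" for n x
  proof (rule blinfun_inv_eqI)
    show "Q.iter n x o\<^sub>L cocycle f A x (int n) = id_blinfun"
      unfolding P_iter
    proof (induction n)
      case (Suc n)
      have "Q.iter (Suc n) x o\<^sub>L P.iter (Suc n) x = Q.iter n x o\<^sub>L
          ((blinfun_inv (A ((f ^^ n) x)) o\<^sub>L A ((f ^^ n) x)) o\<^sub>L P.iter n x)"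
        by (simp add: blinfun_compose_assoc)
      then show ?case using Suc by (simp only: inverses blinfun_compose_monoid)
    qed (simp add: blinfun_compose_monoid)
    show "cocycle f A x (int n) o\<^sub>L Q.iter n x = id_blinfun"
      unfolding P_iter
    proof (induction n)
      case (Suc n)
      have "P.iter (Suc n) x o\<^sub>L Q.iter (Suc n) x = A ((f ^^ n) x) o\<^sub>L
          ((P.iter n x o\<^sub>L Q.iter n x) o\<^sub>L blinfun_inv (A ((f ^^ n) x)))"
        by (simp add: blinfun_compose_assoc)
      then show ?case using Suc by (simp only: inverses blinfun_compose_monoid)
    qed (simp add: blinfun_compose_monoid)
  qed
  obtain \<alpha> L r where pos: "0 < \<alpha>" "0 < L" "0 < r" and
    hoelder: "\<And>x y. dist x y < r \<Longrightarrow> gl_dist (A x) (A y) \<le> L * dist x y powr \<alpha>"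
    using assms(10) unfolding hoelder_generator_def by blast
  have hoelder_A: "norm (A x - A y) \<le> L * dist x y powr \<alpha>"
    and hoelder_inv: "norm (blinfun_inv (A x) - blinfun_inv (A y)) \<le> L * dist x y powr \<alpha>"
    if "dist x y < r" for x y
    using hoelder[OF that] norm_ge_zero[of "A x - A y"]
      norm_ge_zero[of "blinfun_inv (A x) - blinfun_inv (A y)"]
    unfolding gl_dist_def by linarith+
  have "continuous_on UNIV A"
    using hoelder_A by (rule hoelder_imp_continuous[OF pos(3,1)])
  note tame_P = tame_growth[OF cocycle_A system assms(5) cont this]
  have "continuous_on UNIV (\<lambda>x. blinfun_inv (A x))"
    using hoelder_inv by (rule hoelder_imp_continuous[OF pos(3,1)])
  note tame_Q = tame_growth[OF cocycle_inv system assms(5) cont this]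
  have upper: "upper_lyapunov \<mu> f A = rate P.growth"
    unfolding upper_lyapunov_def
    by (rule THE_AE_limit_eq) (use kingman[OF tame_P] in \<open>simp add: P_iter P.growth_def del: cocycle_of_nat\<close>)
  \<comment> \<open>The inverses form the second cocycle, and the logarithm of the reciprocal norm
    reverses the sign of its rate.\<close>
  have lower: "lower_lyapunov \<mu> f A = - rate Q.growth"
    unfolding lower_lyapunov_def
  proof (rule THE_AE_limit_eq)
    show "AE x in \<mu>. (\<lambda>n. 1 / real n * ln (inverse (norm (blinfun_inv (cocycle f A x (int n))))))
        \<longlonglongrightarrow> - rate Q.growth"
      using kingman[OF tame_Q]
    proof eventually_elim
      case (elim x)
      from tendsto_minus[OF this] show ?case
        unfolding Q_iter by (simp add: Q.growth_def ln_inverse)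
    qed
  qed
  have approx: "\<exists>k>N. \<exists>p. (f ^^ k) p = p \<and>
        \<bar>upper_lyapunov \<mu> f A - 1 / real k * ln (norm (cocycle f A p (int k)))\<bar> < \<epsilon> \<and>
        \<bar>lower_lyapunov \<mu> f A
           - 1 / real k * ln (inverse (norm (blinfun_inv (cocycle f A p (int k)))))\<bar> < \<epsilon>"
    if "0 < \<epsilon>" for \<epsilon> :: real and N :: nat
  proof -
    have "\<exists>k>N. \<exists>p. (f ^^ k) p = p \<and> \<bar>rate P.growth - P.growth k p / real k\<bar> < \<epsilon> \<and>
        \<bar>rate Q.growth - Q.growth k p / real k\<bar> < \<epsilon>"
      by (rule periodic_approximation[OF system assms(5,1) cont assms(3) cocycle_A cocycle_inv pos
            _ _ that]) (fact hoelder_A hoelder_inv)+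
    then obtain k p where "k > N" "(f ^^ k) p = p"
      and "\<bar>rate P.growth - P.growth k p / real k\<bar> < \<epsilon>"
      and "\<bar>rate Q.growth - Q.growth k p / real k\<bar> < \<epsilon>"
      by blast
    moreover have "1 / real k * ln (norm (cocycle f A p (int k))) = P.growth k p / real k"
      by (simp only: P_iter P.growth_def) simp
    moreover have "1 / real k * ln (inverse (norm (blinfun_inv (cocycle f A p (int k)))))
        = - (Q.growth k p / real k)"
      by (simp only: Q_iter Q.growth_def ln_inverse) simp
    ultimately show ?thesis
      unfolding upper lower by (intro exI[of _ k] conjI exI[of _ p]) auto
  qed
  \<comment> \<open>\<open>N = 0\<close> yields a positive period and with it the first
    claim.\<close>
  then show ?thesis by blast
qed

end
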